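(* Let $g$ be a non-negative revenue function that is adaptive submodular with respect to the prior $p$ (not necessarily adaptive monotone), let the item costs satisfy $c_e\ge0$ for all $e\in E$, and let $k\ge1$ be an integer. Let $\pi^o\in\arg\max_{\pi\in\Omega}\,g_{avg}(\pi)-c_{avg}(\pi)$ be an optimal policy, where $\Omega$ is the set of all policies selecting at most $k$ items, and let $\pi^r$ be the Adaptive Random Distorted Greedy Policy. Then $$g_{avg}(\pi^r)-c_{avg}(\pi^r)\;\ge\;\frac1e\,g_{avg}(\pi^o)-c_{avg}(\pi^o).$$
   Context: Items and states. $E$ is a finite set of $n$ items and $O$ a set of states. A realization is a function $\phi:E\to O$ ($\phi(e)$ is the state of $e$). $\Phi$ is a random realization with known (discrete) prior distribution $p$, $p(\phi)=\Pr[\Phi=\phi]$. A partial realization $\psi$ is an assignment of states to the items of a subset $\mathrm{dom}(\psi)\subseteq E$; $\phi\sim\psi$ means $\phi$ agrees with $\psi$ on $\mathrm{dom}(\psi)$; $\psi\subseteq\psi'$ means $\mathrm{dom}(\psi)\subseteq\mathrm{dom}(\psi')$ and they agree on $\mathrm{dom}(\psi)$. Only partial realizations with $\Pr[\Phi\sim\psi]>0$ are considered. Revenue and cost. The revenue function assigns to $Y\subseteq E$ and a realization $\phi$ a number $g(Y,\phi)\ge 0$. Each item has a fixed cost $c_e\ge0$, and $c(Y)=\sum_{e\in Y}c_e$. Put $g(e\mid\psi)=\mathbb E[g(\mathrm{dom}(\psi)\cup\{e\},\Phi)-g(\mathrm{dom}(\psi),\Phi)\mid\Phi\sim\psi]$.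 $g$ is adaptive submodular if $g(e\mid\psi)\ge g(e\mid\psi')$ for all $\psi\subseteq\psi'$ and $e\in E\setminus\mathrm{dom}(\psi')$. Policies. A (possibly randomized) policy $\pi$ sequentially selects items; the choice of the next item (or to stop) depends only on the partial realization observed so far (and internal randomness), and the state of an item is observed once it is selected. $E(\pi,\phi)$ is the (random) set of items selected by $\pi$ under $\phi$; $g_{avg}(\pi)=\mathbb E[g(E(\pi,\Phi),\Phi)]$ and $c_{avg}(\pi)=\mathbb E[c(E(\pi,\Phi))]$, the expectations being over $\Phi\sim p$ and the randomness of $\pi$. The policy $\pi^r$. Add a set $D$ of $k-1$ dummy items, each with zero cost and with $g(d\mid\psi)=0$ for every $d\in D$ and every partial realization $\psi$ (selecting a dummy has no effect on revenue or cost), and let $E'=E\cup D$. For $i\in\{0,\dots,k-1\}$ let $H_i(\psi,e)=(1-\frac1k)^{k-(i+1)}g(e\mid\psi)-c_e$ (with $0^0=1$). Start with $\psi_0=\emptyset$. For $i=0,1,\dots,k-1$: let $M(\psi_i)$ be a set of $k$ items of $E'$ that have the largest $H_i(\psi_i,\cdot)$, given by $M(\psi_i)\in\arg\max_{M\subseteq E',\,|M|\le k}\sum_{e\in M}H_i(\psi_i,e)$; sample $e_i$ uniformly at random from $M(\psi_i)$; observe the state $\phi(e_i)$ of $e_i$ and set $\psi_{i+1}=\psi_i\cup\{\phi(e_i)\}$. The selected set is $\{e_0,\dots,e_{k-1}\}$.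
   Formalization: If every item of E has negative H_i, no k-item set attains the stated maximum (only k−1 dummies exist), and forcing k items makes the claim false; in that case M(ψ_i) may be any maximizer (dummies only, possibly empty), and the round selects nothing from E. *)

theory Defs
  imports "HOL-Probability.Probability"
begin

text \<open>
  Items form a set \<open>E\<close>, states a set \<open>Q\<close>. A realization is an element of \<open>E \<rightarrow>\<^sub>E Q\<close>, the prior is
  a pmf \<open>p\<close> on realizations, and a partial realization is a map \<open>\<psi>\<close> with \<open>dom \<psi> \<subseteq> E\<close>;
  inclusion of partial realizations is \<open>\<subseteq>\<^sub>m\<close>. The revenue \<open>g Y \<phi>\<close> may depend on all of \<open>\<phi>\<close>.
\<close>

definition agrees :: "('e \<Rightarrow> 'o) \<Rightarrow> ('e \<rightharpoonup> 'o) \<Rightarrow> bool" where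
  "agrees \<phi> \<psi> \<longleftrightarrow> (\<forall>e\<in>dom \<psi>. \<psi> e = Some (\<phi> e))"

definition feasible :: "('e \<Rightarrow> 'o) pmf \<Rightarrow> 'e set \<Rightarrow> ('e \<rightharpoonup> 'o) \<Rightarrow> bool" where
  "feasible p E \<psi> \<longleftrightarrow> dom \<psi> \<subseteq> E \<and> measure_pmf.prob p {\<phi>. agrees \<phi> \<psi>} > 0"

definition gain ::
  "('e \<Rightarrow> 'o) pmf \<Rightarrow> ('e set \<Rightarrow> ('e \<Rightarrow> 'o) \<Rightarrow> real) \<Rightarrow> ('e \<rightharpoonup> 'o) \<Rightarrow> 'e \<Rightarrow> real" where
  "gain p g \<psi> e =
     measure_pmf.expectation (cond_pmf p {\<phi>. agrees \<phi> \<psi>})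
       (\<lambda>\<phi>. g (dom \<psi> \<union> {e}) \<phi> - g (dom \<psi>) \<phi>)"

definition adaptive_submodular ::
  "('e \<Rightarrow> 'o) pmf \<Rightarrow> 'e set \<Rightarrow> ('e set \<Rightarrow> ('e \<Rightarrow> 'o) \<Rightarrow> real) \<Rightarrow> bool" where
  "adaptive_submodular p E g \<longleftrightarrow>
     (\<forall>\<psi> \<psi>'. feasible p E \<psi> \<longrightarrow> feasible p E \<psi>' \<longrightarrow> \<psi> \<subseteq>\<^sub>m \<psi>' \<longrightarrow>
        (\<forall>e\<in>E - dom \<psi>'. gain p g \<psi> e \<ge> gain p g \<psi>' e))"

text \<open>The partial realization observed after selecting the items of \<open>S\<close> under \<open>\<phi>\<close>.\<close>

definition observed :: "('e \<Rightarrow> 'o) \<Rightarrow> 'e set \<Rightarrow> ('e \<rightharpoonup> 'o)" where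
  "observed \<phi> S = (\<lambda>e. Some (\<phi> e)) |` S"

text \<open>
  A randomized policy maps the observed partial realization to a distribution over the next
  action: \<open>Some e\<close> selects \<open>e\<close>, \<open>None\<close> stops. Only items not yet selected may be selected, so
  \<open>card E\<close> steps exhaust every run.
\<close>

type_synonym ('e, 'o) policy = "('e \<rightharpoonup> 'o) \<Rightarrow> 'e option pmf"

definition is_policy :: "('e \<Rightarrow> 'o) pmf \<Rightarrow> 'e set \<Rightarrow> ('e, 'o) policy \<Rightarrow> bool" where
  "is_policy p E \<pi> \<longleftrightarrow>
     (\<forall>\<psi>. feasible p E \<psi> \<longrightarrow> set_pmf (\<pi> \<psi>) \<subseteq> insert None (Some ` (E - dom \<psi>)))"

primrec run_policy :: "('e, 'o) policy \<Rightarrow> ('e \<Rightarrow> 'o) \<Rightarrow> nat \<Rightarrow> 'e set \<Rightarrow> 'e set pmf" where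
  "run_policy \<pi> \<phi> 0 S = return_pmf S"
| "run_policy \<pi> \<phi> (Suc n) S =
     bind_pmf (\<pi> (observed \<phi> S))
       (\<lambda>a. case a of None \<Rightarrow> return_pmf S | Some e \<Rightarrow> run_policy \<pi> \<phi> n (insert e S))"

definition selected :: "'e set \<Rightarrow> ('e, 'o) policy \<Rightarrow> ('e \<Rightarrow> 'o) \<Rightarrow> 'e set pmf" where
  "selected E \<pi> \<phi> = run_policy \<pi> \<phi> (card E) {}"

definition policies_upto ::
  "('e \<Rightarrow> 'o) pmf \<Rightarrow> 'e set \<Rightarrow> nat \<Rightarrow> ('e, 'o) policy set" where
  "policies_upto p E k =
     {\<pi>. is_policy p E \<pi> \<and> (\<forall>\<phi>\<in>set_pmf p. \<forall>S\<in>set_pmf (selected E \<pi> \<phi>). card S \<le> k)}"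

text \<open>
  Average revenue and cost of a procedure, given by the distribution \<open>K \<phi>\<close> of the set it selects
  under \<open>\<phi>\<close>; the expectation is over the joint distribution of \<open>\<Phi>\<close> and the selected set.
\<close>

definition outcome ::
  "('e \<Rightarrow> 'o) pmf \<Rightarrow> (('e \<Rightarrow> 'o) \<Rightarrow> 'e set pmf) \<Rightarrow> ('e set \<times> ('e \<Rightarrow> 'o)) pmf" where
  "outcome p K = bind_pmf p (\<lambda>\<phi>. map_pmf (\<lambda>S. (S, \<phi>)) (K \<phi>))"

definition g_avg ::
  "('e \<Rightarrow> 'o) pmf \<Rightarrow> ('e set \<Rightarrow> ('e \<Rightarrow> 'o) \<Rightarrow> real) \<Rightarrow>
     (('e \<Rightarrow> 'o) \<Rightarrow> 'e set pmf) \<Rightarrow> real" where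
  "g_avg p g K = measure_pmf.expectation (outcome p K) (\<lambda>(S, \<phi>). g S \<phi>)"

definition c_avg ::
  "('e \<Rightarrow> 'o) pmf \<Rightarrow> ('e \<Rightarrow> real) \<Rightarrow> (('e \<Rightarrow> 'o) \<Rightarrow> 'e set pmf) \<Rightarrow> real" where
  "c_avg p c K = measure_pmf.expectation (outcome p K) (\<lambda>(S, \<phi>). sum c S)"

text \<open>
  Items are tagged \<open>Inl\<close>, dummies \<open>Inr\<close>. Dummies are not recorded in partial realizations or
  selected sets, since selecting one has no effect on revenue, cost or information.
\<close>

definition extended_items :: "'e set \<Rightarrow> nat \<Rightarrow> ('e + nat) set" where
  "extended_items E k = E <+> {..<k - 1}"

definition distorted_gain ::
  "('e \<Rightarrow> 'o) pmf \<Rightarrow> ('e set \<Rightarrow> ('e \<Rightarrow> 'o) \<Rightarrow> real) \<Rightarrow> ('e \<Rightarrow> real) \<Rightarrow>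
     nat \<Rightarrow> nat \<Rightarrow> ('e \<rightharpoonup> 'o) \<Rightarrow> 'e + nat \<Rightarrow> real" where
  "distorted_gain p g c k i \<psi> x =
     (1 - 1 / real k) ^ (k - (i + 1)) * case_sum (gain p g \<psi>) (\<lambda>_. 0) x
       - case_sum c (\<lambda>_. 0) x"

definition max_candidates ::
  "('e \<Rightarrow> 'o) pmf \<Rightarrow> 'e set \<Rightarrow> ('e set \<Rightarrow> ('e \<Rightarrow> 'o) \<Rightarrow> real) \<Rightarrow> ('e \<Rightarrow> real) \<Rightarrow>
     nat \<Rightarrow> nat \<Rightarrow> ('e \<rightharpoonup> 'o) \<Rightarrow> ('e + nat) set \<Rightarrow> bool" where
  "max_candidates p E g c k i \<psi> =
     is_arg_max (\<lambda>M. \<Sum>x\<in>M. distorted_gain p g c k i \<psi> x)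
       (\<lambda>M. M \<subseteq> extended_items E k \<and> card M \<le> k)"

text \<open>
  A candidate rule \<open>M\<close> (with arbitrary tie-breaking) picks in round \<open>i\<close> a maximizer with exactly
  \<open>k\<close> elements. Such a maximizer is missing only if every item of \<open>E\<close> has negative distorted
  gain; then every maximizer consists of dummies only, and any of them is allowed.
\<close>

definition candidate_rule ::
  "('e \<Rightarrow> 'o) pmf \<Rightarrow> 'e set \<Rightarrow> ('e set \<Rightarrow> ('e \<Rightarrow> 'o) \<Rightarrow> real) \<Rightarrow> ('e \<Rightarrow> real) \<Rightarrow>
     nat \<Rightarrow> (nat \<Rightarrow> ('e \<rightharpoonup> 'o) \<Rightarrow> ('e + nat) set) \<Rightarrow> bool" where
  "candidate_rule p E g c k M \<longleftrightarrow>
     (\<forall>i<k. \<forall>\<psi>. feasible p E \<psi> \<longrightarrow>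
        max_candidates p E g c k i \<psi> (M i \<psi>) \<and>
        ((\<exists>X. max_candidates p E g c k i \<psi> X \<and> card X = k) \<longrightarrow> card (M i \<psi>) = k))"

text \<open>
  \<open>ardg M \<phi> i\<close> is the distribution of the set of items selected in rounds \<open>0, \<dots>, i - 1\<close> of
  the Adaptive Random Distorted Greedy Policy. An empty candidate set is possible only in the
  exceptional case above; like a dummy, it leads to no selection.
\<close>

primrec ardg ::
  "(nat \<Rightarrow> ('e \<rightharpoonup> 'o) \<Rightarrow> ('e + nat) set) \<Rightarrow> ('e \<Rightarrow> 'o) \<Rightarrow> nat \<Rightarrow> 'e set pmf" where
  "ardg M \<phi> 0 = return_pmf {}"
| "ardg M \<phi> (Suc i) =
     bind_pmf (ardg M \<phi> i)
       (\<lambda>S. let C = M i (observed \<phi> S) in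
          if C = {} then return_pmf S
          else map_pmf (\<lambda>x. case x of Inl e \<Rightarrow> insert e S | Inr d \<Rightarrow> S) (pmf_of_set C))"

end

theory Submission
  imports Defs
begin

text \<open>
  The potential \<open>(1 - 1/k)^(k - i) * g - c\<close> of the set \<open>S\<close> selected in the first \<open>i\<close> rounds grows in
  expectation by at least \<open>((1 - 1/k)^(k - 1) * g_avg \<pi> - c_avg \<pi>) / k\<close> per round, for every policy \<open>\<pi>\<close>
  with at most \<open>k\<close> selections. The items \<open>U\<close> selected by \<open>\<pi>\<close> compete with the maximizer for round \<open>i\<close>,
  and by adaptive submodularity their gains on top of \<open>S\<close> sum to at least \<open>g (S \<union> U) - g S\<close> in
  expectation. Running \<open>\<pi>\<close> before the greedy rounds shows that the expectation of \<open>g (S \<union> U)\<close> is at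
  least \<open>(1 - 1/k)^i * g_avg \<pi>\<close>: a round selects each of its candidates with probability \<open>1/k\<close>, and
  selecting all of them would leave a nonnegative revenue.
\<close>

subsection \<open>Conditional expectations of mass functions\<close>

text \<open>Conditioning divides the integral of the norm over \<open>A\<close> by the mass of
  \<open>A\<close>, which is positive because \<open>A\<close> meets the support, so finiteness
  survives.\<close>

lemma integrable_cond_pmf:
  fixes f :: "'a \<Rightarrow> real"
  assumes "set_pmf p \<inter> A \<noteq> {}" "integrable (measure_pmf p) f"
  shows "integrable (measure_pmf (cond_pmf p A)) f"
proof (rule integrableI_bounded)
  have "(\<integral>\<^sup>+x. ennreal (norm (f x)) \<partial>cond_pmf p A) =
      (\<integral>\<^sup>+x. ennreal (norm (f x)) * indicator A x \<partial>p) / emeasure p A"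
    using assms(1) by (simp add: cond_pmf.rep_eq nn_integral_uniform_measure)
  moreover have "(\<integral>\<^sup>+x. ennreal (norm (f x)) * indicator A x \<partial>p) \<le> (\<integral>\<^sup>+x. ennreal (norm (f x)) \<partial>p)"
    by (intro nn_integral_mono) (auto split: split_indicator)
  moreover have "(\<integral>\<^sup>+x. ennreal (norm (f x)) \<partial>p) < \<infinity>"
    using assms(2) by (simp add: integrable_iff_bounded)
  moreover have "emeasure p A > 0"
    using measure_measure_pmf_not_zero[OF assms(1)]
    by (simp add: measure_pmf.emeasure_eq_measure zero_less_measure_iff)
  ultimately show "(\<integral>\<^sup>+x. ennreal (norm (f x)) \<partial>cond_pmf p A) < \<infinity>"
    by (metis ennreal_divide_eq_top_iff infinity_ennreal_def not_gr_zero order_le_less_trans top.not_eq_extremum)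
qed auto

text \<open>Redrawing a point inside its own fibre of \<open>X\<close> does not change the
  distribution: the tower property for mass functions.\<close>

lemma bind_cond_pmf_same:
  "bind_pmf p (\<lambda>x. cond_pmf p {y. X x = X y}) = p"
  by (rule bind_cond_pmf_cancel) (auto intro!: arg_cong[where f="measure p"])

text \<open>The tower property for real functions, where \<open>C x\<close> conditions on the fibre
  of \<open>X\<close> through \<open>x\<close>. Nonnegative functions come first; positive and
  negative parts give the rest.\<close>

lemma
  fixes f :: "'a \<Rightarrow> real" and X :: "'a \<Rightarrow> 'b"
  assumes f: "integrable (measure_pmf p) f"
  defines "C \<equiv> \<lambda>x. cond_pmf p {y. X x = X y}"
  shows integrable_cond_expectation:
      "integrable (measure_pmf p) (\<lambda>x. measure_pmf.expectation (C x) f)" (is ?int)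
    and expectation_cond_expectation:
      "measure_pmf.expectation p (\<lambda>x. measure_pmf.expectation (C x) f) = measure_pmf.expectation p f" (is ?eq)
proof -
  have intC: "integrable (C x) h" if "x \<in> set_pmf p" "integrable p h" for x and h :: "'a \<Rightarrow> real"
    unfolding C_def using that by (intro integrable_cond_pmf) auto
  \<comment> \<open>For nonnegative \<open>h\<close> one computation with the nonnegative integral
    yields integrability and value together.\<close>
  have nonneg: "has_bochner_integral p (\<lambda>x. measure_pmf.expectation (C x) h) (measure_pmf.expectation p h)"
    if h: "\<And>x. 0 \<le> h x" "integrable p h" for h :: "'a \<Rightarrow> real"
  proof (rule has_bochner_integral_nn_integral)
    have "(\<integral>\<^sup>+x. ennreal (measure_pmf.expectation (C x) h) \<partial>p) = (\<integral>\<^sup>+x. \<integral>\<^sup>+y. ennreal (h y) \<partial>C x \<partial>p)"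
      using h by (intro nn_integral_cong_AE)
        (auto simp: AE_measure_pmf_iff intC nn_integral_eq_integral)
    also have "\<dots> = (\<integral>\<^sup>+x. ennreal (h x) \<partial>p)"
      unfolding C_def by (subst nn_integral_bind_pmf[symmetric]) (simp add: bind_cond_pmf_same)
    also have "\<dots> = ennreal (measure_pmf.expectation p h)"
      using h by (intro nn_integral_eq_integral) auto
    finally show "(\<integral>\<^sup>+x. ennreal (measure_pmf.expectation (C x) h) \<partial>p) = ennreal (measure_pmf.expectation p h)" .
  qed (use h in auto)
  let ?u = "\<lambda>x. max (f x) 0" and ?v = "\<lambda>x. max (- f x) 0"
  have uv: "integrable p ?u" "integrable p ?v"
    using f by auto
  have split: "f = (\<lambda>x. ?u x - ?v x)"
    by (auto simp: max_def)
  have eqC: "measure_pmf.expectation (C x) f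
      = measure_pmf.expectation (C x) ?u - measure_pmf.expectation (C x) ?v"
    if "x \<in> set_pmf p" for x
    by (subst split, intro Bochner_Integration.integral_diff intC that uv)
  have "has_bochner_integral p
      (\<lambda>x. measure_pmf.expectation (C x) ?u - measure_pmf.expectation (C x) ?v)
      (measure_pmf.expectation p ?u - measure_pmf.expectation p ?v)"
    by (intro has_bochner_integral_diff nonneg uv) auto
  also have "measure_pmf.expectation p ?u - measure_pmf.expectation p ?v = measure_pmf.expectation p f"
    using uv by (subst (3) split) simp
  finally have "has_bochner_integral p (\<lambda>x. measure_pmf.expectation (C x) f) (measure_pmf.expectation p f)"
    by (subst has_bochner_integral_cong_AE) (auto simp: AE_measure_pmf_iff eqC)
  then show ?int ?eq
    by (auto simp: has_bochner_integral_iff)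
qed

subsection \<open>Observed partial realizations\<close>

lemma dom_observed [simp]: "dom (observed \<phi> S) = S"
  by (simp add: observed_def)

lemma observed_eq_iff: "observed \<phi> S = observed \<phi>' S \<longleftrightarrow> (\<forall>e\<in>S. \<phi> e = \<phi>' e)"
  by (auto simp: observed_def restrict_map_def fun_eq_iff)

text \<open>Makes the conditioning event in \<open>gain\<close> a fibre of the observation map, the
  form in which the tower property applies.\<close>

lemma agrees_observed_iff: "agrees \<phi>' (observed \<phi> S) \<longleftrightarrow> observed \<phi> S = observed \<phi>' S"
  by (auto simp: agrees_def observed_eq_iff) (auto simp: observed_def)

lemma observed_map_le: "S \<subseteq> T \<Longrightarrow> observed \<phi> S \<subseteq>\<^sub>m observed \<phi> T"
  by (auto simp: map_le_def observed_def restrict_map_def)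

lemma observed_eq_mono: "observed \<phi> T = observed \<phi>' T \<Longrightarrow> S \<subseteq> T \<Longrightarrow> observed \<phi> S = observed \<phi>' S"
  by (auto simp: observed_eq_iff)

lemma feasible_observed:
  assumes "\<phi> \<in> set_pmf p" "S \<subseteq> E"
  shows "feasible p E (observed \<phi> S)"
  unfolding feasible_def using assms
  by (auto intro!: measure_pmf_posI simp: agrees_observed_iff)

section \<open>Dependence of runs on the states of the selected items\<close>

lemma run_policy_superset: "T \<in> set_pmf (run_policy \<pi> \<phi> n S) \<Longrightarrow> S \<subseteq> T"
proof (induction n arbitrary: S)
  case (Suc n)
  then show ?case by (fastforce split: option.splits)
qed auto

text \<open>A run from \<open>S\<close> that ends in \<open>T\<close> passes only through sets
  between the two, so its choices consult no state outside \<open>T\<close>.\<close>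

lemma run_policy_observed_cong:
  assumes "observed \<phi> T = observed \<phi>' T"
  shows "pmf (run_policy \<pi> \<phi> n S) T = pmf (run_policy \<pi> \<phi>' n S) T"
proof (induction n arbitrary: S)
  case (Suc n)
  show ?case
  proof (cases "S \<subseteq> T")
    case True
    then have "observed \<phi> S = observed \<phi>' S"
      using assms by (rule observed_eq_mono[rotated])
    then show ?thesis
      by (auto simp: pmf_bind Suc.IH split: option.splits intro!: Bochner_Integration.integral_cong)
  next
    \<comment> \<open>Runs never drop items, so \<open>T\<close> cannot be reached from
      \<open>S\<close> and both probabilities are 0.\<close>
    case False
    then have "T \<notin> set_pmf (run_policy \<pi> \<phi> (Suc n) S)" "T \<notin> set_pmf (run_policy \<pi> \<phi>' (Suc n) S)"
      using run_policy_superset by blast+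
    then show ?thesis by (simp add: set_pmf_iff del: run_policy.simps)
  qed
qed simp

text \<open>Split off from the recursion so that a single round can be analysed for an arbitrary
  candidate set.\<close>

definition ardg_step :: "('e + nat) set \<Rightarrow> 'e set \<Rightarrow> 'e set pmf" where
  "ardg_step C S = (if C = {} then return_pmf S
     else map_pmf (\<lambda>x. case x of Inl e \<Rightarrow> insert e S | Inr d \<Rightarrow> S) (pmf_of_set C))"

lemma ardg_Suc: "ardg M \<phi> (Suc i) = bind_pmf (ardg M \<phi> i) (\<lambda>S. ardg_step (M i (observed \<phi> S)) S)"
  by (simp add: ardg_step_def Let_def)

lemma ardg_step_superset: "T \<in> set_pmf (ardg_step C S) \<Longrightarrow> S \<subseteq> T"
  by (auto simp: ardg_step_def split: if_splits sum.splits)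

text \<open>Every earlier round of a run that ends in \<open>S\<close> saw only a subset of
  \<open>S\<close>, so its candidates depend on states in \<open>S\<close> alone. Finiteness of
  \<open>S\<close> leaves finitely many predecessors to sum over.\<close>

lemma ardg_observed_cong:
  assumes "finite S" "observed \<phi> S = observed \<phi>' S"
  shows "pmf (ardg M \<phi> i) S = pmf (ardg M \<phi>' i) S"
  using assms
proof (induction i arbitrary: S)
  case (Suc i)
  have *: "pmf (ardg M \<phi> (Suc i)) S =
      (\<Sum>T\<in>Pow S. pmf (ardg M \<phi> i) T * pmf (ardg_step (M i (observed \<phi> T)) T) S)" for \<phi>
    unfolding ardg_Suc pmf_bind using \<open>finite S\<close> ardg_step_superset[of S]
    by (subst integral_measure_pmf[where A="Pow S"]) (auto simp: set_pmf_iff)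
  show ?case
    unfolding * using Suc.prems
    by (intro sum.cong arg_cong2[where f="(*)"] Suc.IH)
      (auto intro: finite_subset dest: observed_eq_mono)
qed simp

text \<open>Weights on \<open>T\<close> are the test functions for conditioning on the states of the items in \<open>T\<close>.\<close>

definition weight :: "'e set \<Rightarrow> (('e \<Rightarrow> 'o) \<Rightarrow> real) \<Rightarrow> bool" where
  "weight T w \<longleftrightarrow> (\<forall>\<phi>. 0 \<le> w \<phi> \<and> w \<phi> \<le> 1) \<and>
     (\<forall>\<phi> \<phi>'. observed \<phi> T = observed \<phi>' T \<longrightarrow> w \<phi> = w \<phi>')"

lemma weightI:
  assumes "\<And>\<phi>. 0 \<le> w \<phi>" "\<And>\<phi>. w \<phi> \<le> 1"
    "\<And>\<phi> \<phi>'. observed \<phi> T = observed \<phi>' T \<Longrightarrow> w \<phi> = w \<phi>'"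
  shows "weight T w"
  unfolding weight_def using assms by blast

lemma weight_nonneg: "weight T w \<Longrightarrow> 0 \<le> w \<phi>"
  unfolding weight_def by blast

lemma weight_le_1: "weight T w \<Longrightarrow> w \<phi> \<le> 1"
  unfolding weight_def by blast

lemma weight_cong: "weight T w \<Longrightarrow> observed \<phi> T = observed \<phi>' T \<Longrightarrow> w \<phi> = w \<phi>'"
  unfolding weight_def by blast

lemma weight_mono: "weight T w \<Longrightarrow> T \<subseteq> T' \<Longrightarrow> weight T' w"
  unfolding weight_def using observed_eq_mono by blast

lemma weight_mult:
  assumes "weight T v" "weight T w"
  shows "weight T (\<lambda>\<phi>. v \<phi> * w \<phi>)"
proof (rule weightI)
  fix \<phi> \<phi>' :: "'a \<Rightarrow> 'b" assume "observed \<phi> T = observed \<phi>' T"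
  then show "v \<phi> * w \<phi> = v \<phi>' * w \<phi>'"
    using assms by (metis weight_cong)
qed (use assms in \<open>auto intro: mult_nonneg_nonneg mult_le_one weight_nonneg weight_le_1\<close>)

lemma weight_of_bool:
  assumes "\<And>\<phi> \<phi>'. observed \<phi> T = observed \<phi>' T \<Longrightarrow> P \<phi> = P \<phi>'"
  shows "weight T (\<lambda>\<phi>. of_bool (P \<phi>))"
proof (rule weightI)
  fix \<phi> \<phi>' :: "'a \<Rightarrow> 'b" assume "observed \<phi> T = observed \<phi>' T"
  then have "P \<phi> = P \<phi>'" by (rule assms)
  then show "of_bool (P \<phi>) = of_bool (P \<phi>')" by (simp only:)
qed auto

lemma weight_run_policy: "weight T (\<lambda>\<phi>. pmf (run_policy \<pi> \<phi> n S) T)"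
  by (intro weightI run_policy_observed_cong) (auto simp: pmf_le_1)

lemma weight_ardg: "finite T \<Longrightarrow> weight T (\<lambda>\<phi>. pmf (ardg M \<phi> i) T)"
  by (intro weightI ardg_observed_cong) (auto simp: pmf_le_1)

lemma weight_policy: "weight T (\<lambda>\<phi>. pmf (\<pi> (observed \<phi> T)) a)"
  by (intro weightI) (auto simp: pmf_le_1)

section \<open>Integrability and averages over selected sets\<close>

lemma integrable_bounded_mult:
  fixes w f :: "'a \<Rightarrow> real"
  assumes "\<And>x. 0 \<le> w x" "\<And>x. w x \<le> 1" "integrable (measure_pmf p) f"
  shows "integrable (measure_pmf p) (\<lambda>x. w x * f x)"
  by (rule Bochner_Integration.integrable_bound[OF assms(3)])
    (use assms in \<open>auto simp: abs_mult intro!: AE_I2 mult_left_le_one_le\<close>)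

lemma integrable_weight:
  "weight T w \<Longrightarrow> integrable (measure_pmf p) f \<Longrightarrow> integrable (measure_pmf p) (\<lambda>\<phi>. w \<phi> * f \<phi>)"
  by (rule integrable_bounded_mult) (rule weight_nonneg weight_le_1; assumption)+

text \<open>A finite sum in place of an integral: linear without integrability conditions, and
  expandable into terms with one probability each, which serve as weights on realizations. Agreement
  with the expectation requires support in \<open>Pow E\<close>.\<close>

definition avg :: "'e set \<Rightarrow> 'e set pmf \<Rightarrow> ('e set \<Rightarrow> real) \<Rightarrow> real" where
  "avg E K f = (\<Sum>S\<in>Pow E. pmf K S * f S)"

lemma integrable_avg:
  assumes "\<And>S. S \<subseteq> E \<Longrightarrow> integrable (measure_pmf p) (f S)"
  shows "integrable (measure_pmf p) (\<lambda>\<phi>. avg E (K \<phi>) (\<lambda>S. f S \<phi>))"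
  unfolding avg_def using assms
  by (intro Bochner_Integration.integrable_sum integrable_bounded_mult) (auto simp: pmf_le_1)

lemma expectation_eq_avg:
  "finite E \<Longrightarrow> set_pmf K \<subseteq> Pow E \<Longrightarrow> measure_pmf.expectation K f = avg E K f"
  unfolding avg_def by (subst integral_measure_pmf[where A="Pow E"]) auto

lemma avg_cong: "(\<And>S. S \<in> set_pmf K \<Longrightarrow> S \<subseteq> E \<Longrightarrow> f S = h S) \<Longrightarrow> avg E K f = avg E K h"
  unfolding avg_def by (intro sum.cong refl) (auto simp: set_pmf_iff)

lemma avg_mono: "(\<And>S. S \<in> set_pmf K \<Longrightarrow> S \<subseteq> E \<Longrightarrow> f S \<le> h S) \<Longrightarrow> avg E K f \<le> avg E K h"
  unfolding avg_def by (intro sum_mono) (metis PowD mult_left_mono mult_zero_left order.refl pmf_nonneg set_pmf_iff)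

lemma avg_add: "avg E K (\<lambda>S. f S + h S) = avg E K f + avg E K h"
  by (simp add: avg_def distrib_left sum.distrib)

lemma avg_diff: "avg E K (\<lambda>S. f S - h S) = avg E K f - avg E K h"
  by (simp add: avg_def right_diff_distrib sum_subtractf)

lemma avg_cmult: "avg E K (\<lambda>S. a * f S) = a * avg E K f"
  by (simp add: avg_def sum_distrib_left mult_ac)

lemma avg_const: "finite E \<Longrightarrow> set_pmf K \<subseteq> Pow E \<Longrightarrow> avg E K (\<lambda>_. a) = a"
  using expectation_eq_avg[of E K "\<lambda>_. a"] by simp

lemma avg_bind:
  assumes "finite E" "finite A" "set_pmf K \<subseteq> A" "\<And>x. x \<in> A \<Longrightarrow> set_pmf (L x) \<subseteq> Pow E"
  shows "avg E (bind_pmf K L) f = (\<Sum>x\<in>A. pmf K x * avg E (L x) f)"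
proof -
  have "avg E (bind_pmf K L) f = measure_pmf.expectation (bind_pmf K L) f"
    using assms by (intro expectation_eq_avg[symmetric]) auto
  also have "\<dots> = (\<Sum>x\<in>A. pmf K x *\<^sub>R measure_pmf.expectation (L x) f)"
    using assms by (intro pmf_expectation_bind) (simp_all, meson finite_Pow_iff finite_subset)
  also have "\<dots> = (\<Sum>x\<in>A. pmf K x * avg E (L x) f)"
    using assms by (intro sum.cong) (auto simp: expectation_eq_avg)
  finally show ?thesis .
qed

text \<open>Both sides are evaluated as nonnegative integrals, for which the joint expectation
  iterates.\<close>

lemma expectation_outcome:
  assumes "finite E" "\<And>\<phi>. \<phi> \<in> set_pmf p \<Longrightarrow> set_pmf (K \<phi>) \<subseteq> Pow E"
    and "\<And>S \<phi>. \<phi> \<in> set_pmf p \<Longrightarrow> S \<subseteq> E \<Longrightarrow> 0 \<le> f S \<phi>"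
  shows "measure_pmf.expectation (outcome p K) (\<lambda>(S, \<phi>). f S \<phi>)
    = measure_pmf.expectation p (\<lambda>\<phi>. avg E (K \<phi>) (\<lambda>S. f S \<phi>))"
proof -
  have inner: "(\<integral>\<^sup>+S. ennreal (f S \<phi>) \<partial>K \<phi>) = ennreal (avg E (K \<phi>) (\<lambda>S. f S \<phi>))"
    if "\<phi> \<in> set_pmf p" for \<phi>
  proof -
    have "(\<integral>\<^sup>+S. ennreal (f S \<phi>) \<partial>K \<phi>) = ennreal (measure_pmf.expectation (K \<phi>) (\<lambda>S. f S \<phi>))"
      using assms(2)[OF that] assms(3)[OF that] \<open>finite E\<close>
      by (intro nn_integral_eq_integral integrable_measure_pmf_finite)
        (auto simp: AE_measure_pmf_iff intro: finite_subset[of _ "Pow E"])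
    then show ?thesis
      using assms(1) assms(2)[OF that] by (simp add: expectation_eq_avg)
  qed
  have "measure_pmf.expectation (outcome p K) (\<lambda>(S, \<phi>). f S \<phi>)
      = enn2real (\<integral>\<^sup>+x. ennreal (case x of (S, \<phi>) \<Rightarrow> f S \<phi>) \<partial>outcome p K)"
  proof (rule integral_eq_nn_integral)
    have "0 \<le> f S \<phi>" if "(S, \<phi>) \<in> set_pmf (outcome p K)" for S \<phi>
    proof -
      have "\<phi> \<in> set_pmf p" "S \<in> set_pmf (K \<phi>)"
        using that by (auto simp: outcome_def)
      then show ?thesis
        using assms(2,3) by blast
    qed
    then show "AE x in outcome p K. 0 \<le> (case x of (S, \<phi>) \<Rightarrow> f S \<phi>)"
      by (auto simp: AE_measure_pmf_iff)
  qed simp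
  also have "(\<integral>\<^sup>+x. ennreal (case x of (S, \<phi>) \<Rightarrow> f S \<phi>) \<partial>outcome p K)
      = (\<integral>\<^sup>+\<phi>. \<integral>\<^sup>+S. ennreal (f S \<phi>) \<partial>K \<phi> \<partial>p)"
    by (simp add: outcome_def)
  also have "\<dots> = (\<integral>\<^sup>+\<phi>. ennreal (avg E (K \<phi>) (\<lambda>S. f S \<phi>)) \<partial>p)"
    by (intro nn_integral_cong_AE) (auto simp: AE_measure_pmf_iff inner)
  also have "enn2real \<dots> = measure_pmf.expectation p (\<lambda>\<phi>. avg E (K \<phi>) (\<lambda>S. f S \<phi>))"
    using assms(3)
    by (intro integral_eq_nn_integral[symmetric])
      (auto simp: AE_measure_pmf_iff avg_def intro!: sum_nonneg mult_nonneg_nonneg)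
  finally show ?thesis .
qed

lemma expectation_mono:
  fixes f h :: "'a \<Rightarrow> real"
  assumes "integrable (measure_pmf p) f" "integrable (measure_pmf p) h"
    "\<And>x. x \<in> set_pmf p \<Longrightarrow> f x \<le> h x"
  shows "measure_pmf.expectation p f \<le> measure_pmf.expectation p h"
  using assms by (intro integral_mono_AE) (auto simp: AE_measure_pmf_iff)

lemma expectation_cong:
  fixes f h :: "'a \<Rightarrow> real"
  assumes "\<And>x. x \<in> set_pmf p \<Longrightarrow> f x = h x"
  shows "measure_pmf.expectation p f = measure_pmf.expectation p h"
  using assms by (intro integral_cong_AE) (auto simp: AE_measure_pmf_iff)

text \<open>The way later expectations are localized: \<open>h\<close> is broken into terms whose
  weights each depend on the states in a single set, and the terms are bounded separately.\<close>

lemma expectation_weighted_sum: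
  assumes "\<And>i. i \<in> I \<Longrightarrow> weight (T i) (w i)" "\<And>i. i \<in> I \<Longrightarrow> integrable (measure_pmf p) (f i)"
    and "\<And>\<phi>. \<phi> \<in> set_pmf p \<Longrightarrow> h \<phi> = (\<Sum>i\<in>I. w i \<phi> * f i \<phi>)"
  shows "measure_pmf.expectation p h = (\<Sum>i\<in>I. measure_pmf.expectation p (\<lambda>\<phi>. w i \<phi> * f i \<phi>))"
proof -
  have "measure_pmf.expectation p h = measure_pmf.expectation p (\<lambda>\<phi>. \<Sum>i\<in>I. w i \<phi> * f i \<phi>)"
    using assms(3) by (rule expectation_cong)
  also have "\<dots> = (\<Sum>i\<in>I. measure_pmf.expectation p (\<lambda>\<phi>. w i \<phi> * f i \<phi>))"
    using assms(1,2) by (intro Bochner_Integration.integral_sum) (rule integrable_weight)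
  finally show ?thesis .
qed

lemma gain_selected: "e \<in> dom \<psi> \<Longrightarrow> gain p g \<psi> e = 0"
  by (simp add: gain_def insert_absorb)

subsection \<open>Expected gains under adaptive submodularity\<close>

locale adaptive_revenue =
  fixes p :: "('e \<Rightarrow> 'o) pmf" and E :: "'e set" and g :: "'e set \<Rightarrow> ('e \<Rightarrow> 'o) \<Rightarrow> real"
  assumes finite_items: "finite E"
    and nonneg: "\<phi> \<in> set_pmf p \<Longrightarrow> Y \<subseteq> E \<Longrightarrow> 0 \<le> g Y \<phi>"
    and integrable_revenue: "Y \<subseteq> E \<Longrightarrow> integrable (measure_pmf p) (g Y)"
    and submodular: "adaptive_submodular p E g"
begin

abbreviation expected :: "(('e \<Rightarrow> 'o) \<Rightarrow> real) \<Rightarrow> real" where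
  "expected \<equiv> measure_pmf.expectation p"

abbreviation \<Delta> :: "('e \<Rightarrow> 'o) \<Rightarrow> 'e set \<Rightarrow> 'e \<Rightarrow> real" where
  "\<Delta> \<phi> T e \<equiv> gain p g (observed \<phi> T) e"

lemma gain_observed:
  "\<Delta> \<phi> T e = measure_pmf.expectation (cond_pmf p {\<phi>'. observed \<phi> T = observed \<phi>' T})
     (\<lambda>\<phi>'. g (insert e T) \<phi>' - g T \<phi>')"
  by (simp add: gain_def agrees_observed_iff)

lemma integrable_gain:
  "T \<subseteq> E \<Longrightarrow> e \<in> E \<Longrightarrow> integrable (measure_pmf p) (\<lambda>\<phi>. \<Delta> \<phi> T e)"
  unfolding gain_observed
  by (intro integrable_cond_expectation Bochner_Integration.integrable_diff integrable_revenue) auto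

text \<open>\<open>w\<close> is constant on every event that fixes the states in \<open>T\<close>,
  so it passes through the conditional expectation and the tower property does the rest.\<close>

lemma expected_gain:
  assumes "weight T w" "T \<subseteq> E" "e \<in> E"
  shows "expected (\<lambda>\<phi>. w \<phi> * (g (insert e T) \<phi> - g T \<phi>)) = expected (\<lambda>\<phi>. w \<phi> * \<Delta> \<phi> T e)"
proof -
  let ?C = "\<lambda>\<phi>. cond_pmf p {\<phi>'. observed \<phi> T = observed \<phi>' T}"
  let ?d = "\<lambda>\<phi>. g (insert e T) \<phi> - g T \<phi>"
  have "expected (\<lambda>\<phi>. w \<phi> * ?d \<phi>)
      = expected (\<lambda>\<phi>. measure_pmf.expectation (?C \<phi>) (\<lambda>\<phi>'. w \<phi>' * ?d \<phi>'))"
    using assms by (intro expectation_cond_expectation[symmetric] integrable_weight[OF assms(1)]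
      Bochner_Integration.integrable_diff integrable_revenue) auto
  also have "\<dots> = expected (\<lambda>\<phi>. measure_pmf.expectation (?C \<phi>) (\<lambda>\<phi>'. w \<phi> * ?d \<phi>'))"
  proof (intro expectation_cong)
    fix \<phi> \<phi>' assume *: "\<phi> \<in> set_pmf p" "\<phi>' \<in> set_pmf (?C \<phi>)"
    then have "set_pmf p \<inter> {\<phi>'. observed \<phi> T = observed \<phi>' T} \<noteq> {}" by auto
    with * have "observed \<phi> T = observed \<phi>' T" by simp
    then have "w \<phi>' = w \<phi>" using weight_cong[OF assms(1)] by metis
    then show "w \<phi>' * ?d \<phi>' = w \<phi> * ?d \<phi>'" by simp
  qed
  also have "\<dots> = expected (\<lambda>\<phi>. w \<phi> * \<Delta> \<phi> T e)"
    by (simp add: gain_observed)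
  finally show ?thesis .
qed

text \<open>For \<open>e\<close> in \<open>T\<close> both gains are 0. Items of
  \<open>T' - T\<close> are excluded: their gain over \<open>T'\<close> is 0, while their gain over
  \<open>T\<close> may be negative, as revenue need not be monotone.\<close>

lemma gain_antimono:
  assumes "\<phi> \<in> set_pmf p" "T \<subseteq> T'" "T' \<subseteq> E" "e \<in> E" "e \<notin> T' - T"
  shows "\<Delta> \<phi> T' e \<le> \<Delta> \<phi> T e"
proof (cases "e \<in> T")
  case True
  then show ?thesis using assms by (auto simp: gain_selected)
next
  case False
  with assms have e: "e \<in> E - dom (observed \<phi> T')" by auto
  have "feasible p E (observed \<phi> T)" "feasible p E (observed \<phi> T')"
    using assms by (auto intro!: feasible_observed)
  then show ?thesis
    using submodular e observed_map_le[OF \<open>T \<subseteq> T'\<close>] unfolding adaptive_submodular_def by blast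
qed

text \<open>In expectation the actual increment over \<open>T'\<close> is the gain over
  \<open>T'\<close>, which is at most the gain over the smaller \<open>T\<close>. The weight may
  depend on all states in \<open>T'\<close>, so it can encode a history richer than
  \<open>T\<close>.\<close>

lemma expected_increment_le:
  assumes "weight T' w" "T \<subseteq> T'" "T' \<subseteq> E" "e \<in> E" "e \<notin> T' - T"
  shows "expected (\<lambda>\<phi>. w \<phi> * (g (insert e T') \<phi> - g T' \<phi>)) \<le> expected (\<lambda>\<phi>. w \<phi> * \<Delta> \<phi> T e)"
proof -
  have "T \<subseteq> E" using assms by auto
  then show ?thesis
    unfolding expected_gain[OF assms(1,3,4)]
    using assms gain_antimono
    by (intro expectation_mono integrable_weight[OF assms(1)] integrable_gain mult_left_mono
        weight_nonneg[OF assms(1)]) auto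
qed

lemma integrable_sum_gain:
  "T \<subseteq> E \<Longrightarrow> B \<subseteq> E \<Longrightarrow> integrable (measure_pmf p) (\<lambda>\<phi>. \<Sum>e\<in>B. \<Delta> \<phi> T e)"
  by (intro Bochner_Integration.integrable_sum integrable_gain) auto

text \<open>Items of \<open>B\<close> are added one at a time; the increment of each over
  \<open>T\<close> and its predecessors is at most its gain over \<open>T\<close>.\<close>

lemma expected_union_le:
  assumes "weight T w" "T \<subseteq> E" "B \<subseteq> E"
  shows "expected (\<lambda>\<phi>. w \<phi> * (g (T \<union> B) \<phi> - g T \<phi>)) \<le> expected (\<lambda>\<phi>. w \<phi> * (\<Sum>e\<in>B. \<Delta> \<phi> T e))"
proof -
  have "finite B" using assms finite_items by (auto intro: finite_subset)
  then show ?thesis using \<open>B \<subseteq> E\<close>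
  proof (induction B rule: finite_induct)
    case (insert e B)
    have *: "T \<union> B \<subseteq> E" "insert e (T \<union> B) \<subseteq> E" "e \<in> E" "B \<subseteq> E"
      using insert assms by auto
    note int = integrable_weight[OF assms(1)] Bochner_Integration.integrable_diff integrable_revenue
      integrable_gain integrable_sum_gain
    have "expected (\<lambda>\<phi>. w \<phi> * (g (T \<union> insert e B) \<phi> - g T \<phi>))
        = expected (\<lambda>\<phi>. w \<phi> * (g (insert e (T \<union> B)) \<phi> - g (T \<union> B) \<phi>) + w \<phi> * (g (T \<union> B) \<phi> - g T \<phi>))"
      by (simp add: algebra_simps)
    also have "\<dots> = expected (\<lambda>\<phi>. w \<phi> * (g (insert e (T \<union> B)) \<phi> - g (T \<union> B) \<phi>))
        + expected (\<lambda>\<phi>. w \<phi> * (g (T \<union> B) \<phi> - g T \<phi>))"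
      using * assms by (intro Bochner_Integration.integral_add int) auto
    also have "\<dots> \<le> expected (\<lambda>\<phi>. w \<phi> * \<Delta> \<phi> T e) + expected (\<lambda>\<phi>. w \<phi> * (\<Sum>e\<in>B. \<Delta> \<phi> T e))"
      using * assms insert
      by (intro add_mono expected_increment_le insert.IH weight_mono[OF assms(1)]) auto
    also have "\<dots> = expected (\<lambda>\<phi>. w \<phi> * (\<Sum>e\<in>insert e B. \<Delta> \<phi> T e))"
      using insert * assms
      by (subst Bochner_Integration.integral_add[symmetric])
        (auto simp: distrib_left intro!: int)
    finally show ?case .
  qed simp
qed

lemma weighted_sum_subset:
  assumes "B \<subseteq> E"
  shows "w * (\<Sum>e\<in>B. f e) = (\<Sum>e\<in>E. (w * of_bool (e \<in> B)) * (f e :: real))"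
  using assms finite_items
  by (simp add: sum_distrib_left of_bool_def if_distrib if_distribR sum.If_cases Int_absorb1 cong: if_cong)

text \<open>Versions for a set \<open>B\<close> chosen from the states in \<open>T\<close>. The
  first splits by item, the indicator of \<open>e \<in> B \<phi>\<close> joining the weight; the
  second splits by the value of \<open>B\<close>, so that the bound for a fixed set applies.\<close>

lemma
  assumes w: "weight T w" and "T \<subseteq> E"
    and B: "\<And>\<phi>. \<phi> \<in> set_pmf p \<Longrightarrow> B \<phi> \<subseteq> E"
    and B_cong: "\<And>\<phi> \<phi>'. observed \<phi> T = observed \<phi>' T \<Longrightarrow> B \<phi> = B \<phi>'"
  shows expected_random_gain:
      "expected (\<lambda>\<phi>. w \<phi> * (\<Sum>e\<in>B \<phi>. g (insert e T) \<phi> - g T \<phi>)) = expected (\<lambda>\<phi>. w \<phi> * (\<Sum>e\<in>B \<phi>. \<Delta> \<phi> T e))"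
    and expected_random_gain_ge:
      "expected (\<lambda>\<phi>. w \<phi> * (\<Sum>e\<in>B \<phi>. \<Delta> \<phi> T e)) \<ge> - expected (\<lambda>\<phi>. w \<phi> * g T \<phi>)"
proof -
  have w': "weight T (\<lambda>\<phi>. w \<phi> * of_bool (P (B \<phi>)))" for P
    using B_cong by (intro weight_mult w weight_of_bool) metis
  have "expected (\<lambda>\<phi>. w \<phi> * (\<Sum>e\<in>B \<phi>. g (insert e T) \<phi> - g T \<phi>))
      = (\<Sum>e\<in>E. expected (\<lambda>\<phi>. (w \<phi> * of_bool (e \<in> B \<phi>)) * (g (insert e T) \<phi> - g T \<phi>)))"
    using \<open>T \<subseteq> E\<close> B
    by (intro expectation_weighted_sum[OF w'] weighted_sum_subset Bochner_Integration.integrable_diff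
        integrable_revenue) auto
  also have "\<dots> = (\<Sum>e\<in>E. expected (\<lambda>\<phi>. (w \<phi> * of_bool (e \<in> B \<phi>)) * \<Delta> \<phi> T e))"
    using \<open>T \<subseteq> E\<close> by (intro sum.cong refl expected_gain w') auto
  also have "\<dots> = expected (\<lambda>\<phi>. w \<phi> * (\<Sum>e\<in>B \<phi>. \<Delta> \<phi> T e))"
    using \<open>T \<subseteq> E\<close> B
    by (intro expectation_weighted_sum[OF w', symmetric] weighted_sum_subset integrable_gain) auto
  finally show "expected (\<lambda>\<phi>. w \<phi> * (\<Sum>e\<in>B \<phi>. g (insert e T) \<phi> - g T \<phi>))
      = expected (\<lambda>\<phi>. w \<phi> * (\<Sum>e\<in>B \<phi>. \<Delta> \<phi> T e))" .
  have partition: "w \<phi> * h (B \<phi>) = (\<Sum>X\<in>Pow E. (w \<phi> * of_bool (B \<phi> = X)) * (h X :: real))"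
    if "\<phi> \<in> set_pmf p" for \<phi> h
    using B[OF that] finite_items by (subst sum.remove[where x="B \<phi>"]) (auto intro!: sum.neutral)
  have "- expected (\<lambda>\<phi>. w \<phi> * g T \<phi>) = expected (\<lambda>\<phi>. w \<phi> * - g T \<phi>)"
    by simp
  also have "\<dots> = (\<Sum>X\<in>Pow E. expected (\<lambda>\<phi>. (w \<phi> * of_bool (B \<phi> = X)) * - g T \<phi>))"
    using \<open>T \<subseteq> E\<close>
    by (intro expectation_weighted_sum[OF w'] partition Bochner_Integration.integrable_minus
        integrable_revenue)
  \<comment> \<open>Nonnegativity of the revenue of \<open>T \<union> X\<close> allows adding
    it.\<close>
  also have "\<dots> \<le> (\<Sum>X\<in>Pow E. expected (\<lambda>\<phi>. (w \<phi> * of_bool (B \<phi> = X)) * (g (T \<union> X) \<phi> - g T \<phi>)))"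
    using \<open>T \<subseteq> E\<close> nonneg
    by (intro sum_mono expectation_mono integrable_weight[OF w'] Bochner_Integration.integrable_diff
        Bochner_Integration.integrable_minus integrable_revenue mult_left_mono weight_nonneg[OF w']) auto
  also have "\<dots> \<le> (\<Sum>X\<in>Pow E. expected (\<lambda>\<phi>. (w \<phi> * of_bool (B \<phi> = X)) * (\<Sum>e\<in>X. \<Delta> \<phi> T e)))"
    using \<open>T \<subseteq> E\<close> by (intro sum_mono expected_union_le w') auto
  also have "\<dots> = expected (\<lambda>\<phi>. w \<phi> * (\<Sum>e\<in>B \<phi>. \<Delta> \<phi> T e))"
    using \<open>T \<subseteq> E\<close>
    by (intro expectation_weighted_sum[OF w', symmetric] partition integrable_sum_gain) auto
  finally show "expected (\<lambda>\<phi>. w \<phi> * (\<Sum>e\<in>B \<phi>. \<Delta> \<phi> T e)) \<ge> - expected (\<lambda>\<phi>. w \<phi> * g T \<phi>)" .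
qed

end

section \<open>Runs of a policy compared with gains over a fixed set\<close>

lemma avg_return: "finite E \<Longrightarrow> T \<subseteq> E \<Longrightarrow> avg E (return_pmf T) f = f T"
  using expectation_eq_avg[of E "return_pmf T" f] by simp

lemma run_policy_subset:
  assumes "is_policy p E \<pi>" "\<phi> \<in> set_pmf p" "T \<subseteq> E"
  shows "set_pmf (run_policy \<pi> \<phi> n T) \<subseteq> Pow E"
  using assms(3)
proof (induction n arbitrary: T)
  case (Suc n)
  have *: "set_pmf (\<pi> (observed \<phi> T)) \<subseteq> insert None (Some ` (E - T))"
    using assms(1) feasible_observed[OF assms(2) Suc.prems] unfolding is_policy_def by force
  then have "set_pmf (case a of None \<Rightarrow> return_pmf T | Some e \<Rightarrow> run_policy \<pi> \<phi> n (insert e T)) \<subseteq> Pow E"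
    if "a \<in> set_pmf (\<pi> (observed \<phi> T))" for a
  proof (cases a)
    case (Some e)
    then have "insert e T \<subseteq> E" using * that Suc.prems by auto
    then show ?thesis using Suc.IH Some by simp
  qed (use Suc.prems in simp)
  then show ?case by simp blast
qed simp

lemma avg_run_policy_Suc:
  assumes "finite E" "is_policy p E \<pi>" "\<phi> \<in> set_pmf p" "T \<subseteq> E"
  shows "avg E (run_policy \<pi> \<phi> (Suc n) T) f = pmf (\<pi> (observed \<phi> T)) None * f T +
    (\<Sum>e\<in>E - T. pmf (\<pi> (observed \<phi> T)) (Some e) * avg E (run_policy \<pi> \<phi> n (insert e T)) f)"
proof -
  have "set_pmf (\<pi> (observed \<phi> T)) \<subseteq> insert None (Some ` (E - T))"
    using assms(2) feasible_observed[OF assms(3,4)] unfolding is_policy_def by force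
  then have "avg E (run_policy \<pi> \<phi> (Suc n) T) f = (\<Sum>a\<in>insert None (Some ` (E - T)).
      pmf (\<pi> (observed \<phi> T)) a *
      avg E (case a of None \<Rightarrow> return_pmf T | Some e \<Rightarrow> run_policy \<pi> \<phi> n (insert e T)) f)"
    unfolding run_policy.simps
  proof (intro avg_bind)
    fix a assume "a \<in> insert None (Some ` (E - T))"
    then show "set_pmf (case a of None \<Rightarrow> return_pmf T | Some e \<Rightarrow> run_policy \<pi> \<phi> n (insert e T)) \<subseteq> Pow E"
      using assms(4) run_policy_subset[OF assms(2,3), of "insert (the a) T" n] by (cases a) auto
  qed (use assms(1) in auto)
  then show ?thesis
    using assms(1,4) by (simp add: sum.reindex avg_return del: run_policy.simps)
qed

text \<open>Indicators turn the random index set into the fixed finite set \<open>E\<close>.\<close>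

lemma integrable_random_sum:
  fixes f :: "'e \<Rightarrow> 'a \<Rightarrow> real"
  assumes "finite E" "\<And>x. x \<in> set_pmf p \<Longrightarrow> B x \<subseteq> E" "\<And>e. e \<in> E \<Longrightarrow> integrable (measure_pmf p) (f e)"
  shows "integrable (measure_pmf p) (\<lambda>x. \<Sum>e\<in>B x. f e x)"
proof -
  have "integrable (measure_pmf p) (\<lambda>x. \<Sum>e\<in>E. of_bool (e \<in> B x) * f e x)"
    using assms by (intro Bochner_Integration.integrable_sum integrable_bounded_mult) auto
  moreover have "(\<Sum>e\<in>E. of_bool (e \<in> B x) * f e x) = (\<Sum>e\<in>B x. f e x)" if "x \<in> set_pmf p" for x
    using assms(1) assms(2)[OF that] by (subst sum_of_bool_mult_eq) (simp_all add: Int_absorb1)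
  ultimately show ?thesis
    by (subst (asm) integrable_cong_AE) (auto simp: AE_measure_pmf_iff)
qed

context adaptive_revenue
begin

text \<open>Induction over the steps of a run, comparing the gains over \<open>S\<close> of the
  items added after \<open>T\<close> with the revenue they actually add to
  \<open>S \<union> T\<close>. The weight is arbitrary because each choice multiplies it by a
  probability that depends on the observed states, and the induction hypothesis has to follow that
  branch.\<close>

lemma expected_policy_gain_nonneg:
  assumes \<pi>: "is_policy p E \<pi>" and "S \<subseteq> E"
    and "weight (S \<union> T) w" "T \<subseteq> E"
  shows "0 \<le> expected (\<lambda>\<phi>. w \<phi> * avg E (run_policy \<pi> \<phi> n T)
    (\<lambda>U. (\<Sum>e\<in>U - T. \<Delta> \<phi> S e) - (g (S \<union> U) \<phi> - g (S \<union> T) \<phi>)))"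
  using assms(3,4)
proof (induction n arbitrary: T w)
  case 0
  then show ?case by (simp add: avg_return finite_items)
next
  case (Suc n)
  let ?D = "\<lambda>T \<phi> U. (\<Sum>e\<in>U - T. \<Delta> \<phi> S e) - (g (S \<union> U) \<phi> - g (S \<union> T) \<phi>)"
  \<comment> \<open>\<open>?X e\<close> is the surplus of the rest of the run after selecting
    \<open>e\<close>; \<open>?Y e\<close> is the surplus of that one selection.\<close>
  let ?X = "\<lambda>e \<phi>. avg E (run_policy \<pi> \<phi> n (insert e T)) (?D (insert e T) \<phi>)"
  let ?Y = "\<lambda>e \<phi>. \<Delta> \<phi> S e - (g (insert e (S \<union> T)) \<phi> - g (S \<union> T) \<phi>)"
  let ?w = "\<lambda>e \<phi>. w \<phi> * pmf (\<pi> (observed \<phi> T)) (Some e)"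
  have w: "weight (S \<union> insert e T) (?w e)" "weight (S \<union> T) (?w e)" for e
    by (intro weight_mult weight_mono[OF Suc.prems(1)] weight_mono[OF weight_policy]; blast)+
  have int: "integrable p (?X e)" "integrable p (?Y e)" if "e \<in> E - T" for e
    using that assms(2) Suc.prems(2)
    by (auto intro!: integrable_avg Bochner_Integration.integrable_diff integrable_sum_gain
        integrable_revenue integrable_gain)
  have step: "avg E (run_policy \<pi> \<phi> n (insert e T)) (?D T \<phi>) = ?X e \<phi> + ?Y e \<phi>"
    if "\<phi> \<in> set_pmf p" "e \<in> E - T" for \<phi> e
  proof -
    have "avg E (run_policy \<pi> \<phi> n (insert e T)) (?D T \<phi>)
        = avg E (run_policy \<pi> \<phi> n (insert e T)) (\<lambda>U. ?D (insert e T) \<phi> U + ?Y e \<phi>)"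
    proof (rule avg_cong)
      fix U assume U: "U \<in> set_pmf (run_policy \<pi> \<phi> n (insert e T))" "U \<subseteq> E"
      then have "insert e T \<subseteq> U" by (intro run_policy_superset)
      then have "U - T = insert e (U - insert e T)" using that by auto
      then have "(\<Sum>e\<in>U - T. \<Delta> \<phi> S e) = (\<Sum>e\<in>insert e (U - insert e T). \<Delta> \<phi> S e)"
        by (rule arg_cong)
      also have "\<dots> = \<Delta> \<phi> S e + (\<Sum>e\<in>U - insert e T. \<Delta> \<phi> S e)"
        using U finite_items by (intro sum.insert) (auto intro: finite_subset)
      finally have "(\<Sum>e\<in>U - T. \<Delta> \<phi> S e) = \<Delta> \<phi> S e + (\<Sum>e\<in>U - insert e T. \<Delta> \<phi> S e)" .
      then show "?D T \<phi> U = ?D (insert e T) \<phi> U + ?Y e \<phi>" by simp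
    qed
    also have "\<dots> = ?X e \<phi> + ?Y e \<phi>"
      unfolding avg_add[of E _ "?D (insert e T) \<phi>"]
      using that Suc.prems(2) finite_items run_policy_subset[OF \<pi> that(1), of "insert e T" n]
      by (subst avg_const) auto
    finally show ?thesis .
  qed
  \<comment> \<open>Stopping contributes 0, because then \<open>U = T\<close>: the sum is empty and
    the revenue unchanged. Only the choices of an item remain.\<close>
  have "expected (\<lambda>\<phi>. w \<phi> * avg E (run_policy \<pi> \<phi> (Suc n) T) (?D T \<phi>))
      = (\<Sum>e\<in>E - T. expected (\<lambda>\<phi>. ?w e \<phi> * (?X e \<phi> + ?Y e \<phi>)))"
  proof (rule expectation_weighted_sum[OF w(2)])
    fix \<phi> assume "\<phi> \<in> set_pmf p"
    then show "w \<phi> * avg E (run_policy \<pi> \<phi> (Suc n) T) (?D T \<phi>) = (\<Sum>e\<in>E - T. ?w e \<phi> * (?X e \<phi> + ?Y e \<phi>))"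
      using Suc.prems(2) finite_items
      by (simp add: avg_run_policy_Suc[OF _ \<pi>] step sum_distrib_left mult.assoc del: run_policy.simps)
  qed (intro Bochner_Integration.integrable_add int)
  also have "\<dots> = (\<Sum>e\<in>E - T. expected (\<lambda>\<phi>. ?w e \<phi> * ?X e \<phi>) +
      (expected (\<lambda>\<phi>. ?w e \<phi> * \<Delta> \<phi> S e) -
       expected (\<lambda>\<phi>. ?w e \<phi> * (g (insert e (S \<union> T)) \<phi> - g (S \<union> T) \<phi>))))"
  proof (rule sum.cong[OF refl])
    fix e assume e: "e \<in> E - T"
    have "expected (\<lambda>\<phi>. ?w e \<phi> * (?X e \<phi> + ?Y e \<phi>))
        = expected (\<lambda>\<phi>. ?w e \<phi> * ?X e \<phi>) + expected (\<lambda>\<phi>. ?w e \<phi> * ?Y e \<phi>)"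
      unfolding distrib_left by (intro Bochner_Integration.integral_add integrable_weight[OF w(2)] int e)
    also have "expected (\<lambda>\<phi>. ?w e \<phi> * ?Y e \<phi>) = expected (\<lambda>\<phi>. ?w e \<phi> * \<Delta> \<phi> S e) -
       expected (\<lambda>\<phi>. ?w e \<phi> * (g (insert e (S \<union> T)) \<phi> - g (S \<union> T) \<phi>))"
      unfolding right_diff_distrib[of "?w e _" "\<Delta> _ S e"]
      using e assms(2) Suc.prems(2)
      by (intro Bochner_Integration.integral_diff integrable_weight[OF w(2)] integrable_gain
          Bochner_Integration.integrable_diff integrable_revenue) auto
    finally show "expected (\<lambda>\<phi>. ?w e \<phi> * (?X e \<phi> + ?Y e \<phi>)) = expected (\<lambda>\<phi>. ?w e \<phi> * ?X e \<phi>) +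
      (expected (\<lambda>\<phi>. ?w e \<phi> * \<Delta> \<phi> S e) -
       expected (\<lambda>\<phi>. ?w e \<phi> * (g (insert e (S \<union> T)) \<phi> - g (S \<union> T) \<phi>)))" .
  qed
  also have "\<dots> \<ge> 0"
  proof (rule sum_nonneg)
    fix e assume e: "e \<in> E - T"
    have "0 \<le> expected (\<lambda>\<phi>. ?w e \<phi> * ?X e \<phi>)"
      using e Suc.prems(2) by (intro Suc.IH w(1)) auto
    \<comment> \<open>Adaptive submodularity for one selection. The item may already lie in
      \<open>S\<close>, a case that \<open>expected_increment_le\<close> admits.\<close>
    moreover have "expected (\<lambda>\<phi>. ?w e \<phi> * (g (insert e (S \<union> T)) \<phi> - g (S \<union> T) \<phi>))
        \<le> expected (\<lambda>\<phi>. ?w e \<phi> * \<Delta> \<phi> S e)"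
      using e assms(2) Suc.prems(2) by (intro expected_increment_le w(2)) auto
    ultimately show "0 \<le> expected (\<lambda>\<phi>. ?w e \<phi> * ?X e \<phi>) + (expected (\<lambda>\<phi>. ?w e \<phi> * \<Delta> \<phi> S e) -
       expected (\<lambda>\<phi>. ?w e \<phi> * (g (insert e (S \<union> T)) \<phi> - g (S \<union> T) \<phi>)))"
      by linarith
  qed
  finally show ?case .
qed

text \<open>The preceding bound at \<open>T = {}\<close>, with the two sides separated by
  linearity.\<close>

lemma expected_policy_gain:
  assumes "is_policy p E \<pi>" "S \<subseteq> E" "weight S w"
  shows "expected (\<lambda>\<phi>. w \<phi> * avg E (selected E \<pi> \<phi>) (\<lambda>U. g (S \<union> U) \<phi> - g S \<phi>))
    \<le> expected (\<lambda>\<phi>. w \<phi> * avg E (selected E \<pi> \<phi>) (\<lambda>U. \<Sum>e\<in>U. \<Delta> \<phi> S e))"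
proof -
  have "0 \<le> expected (\<lambda>\<phi>. w \<phi> * avg E (selected E \<pi> \<phi>) (\<lambda>U. (\<Sum>e\<in>U. \<Delta> \<phi> S e) - (g (S \<union> U) \<phi> - g S \<phi>)))"
    using expected_policy_gain_nonneg[OF assms(1,2), of "{}" w "card E"] assms(3)
    by (simp add: selected_def)
  also have "\<dots> = expected (\<lambda>\<phi>. w \<phi> * avg E (selected E \<pi> \<phi>) (\<lambda>U. \<Sum>e\<in>U. \<Delta> \<phi> S e))
      - expected (\<lambda>\<phi>. w \<phi> * avg E (selected E \<pi> \<phi>) (\<lambda>U. g (S \<union> U) \<phi> - g S \<phi>))"
    unfolding avg_diff[of E _ "\<lambda>U. \<Sum>e\<in>U. \<Delta> _ S e"] right_diff_distrib[of "w _" "avg _ _ (\<lambda>U. \<Sum>e\<in>U. \<Delta> _ S e)"]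
    using assms(2)
    by (intro Bochner_Integration.integral_diff integrable_weight[OF assms(3)] integrable_avg
        Bochner_Integration.integrable_diff integrable_sum_gain integrable_revenue) auto
  finally show ?thesis by simp
qed

end

lemma sum_Inl_part:
  fixes f :: "'a + 'b \<Rightarrow> real"
  assumes "finite M" "\<And>d. f (Inr d) = 0"
  shows "sum f M = (\<Sum>e\<in>{e. Inl e \<in> M}. f (Inl e))"
proof -
  have "sum f M = sum f (Inl ` {e. Inl e \<in> M})"
  proof (rule sum.mono_neutral_right[OF assms(1)])
    show "\<forall>x\<in>M - Inl ` {e. Inl e \<in> M}. f x = 0"
    proof
      fix x assume "x \<in> M - Inl ` {e. Inl e \<in> M}"
      then show "f x = 0" using assms(2) by (cases x) auto
    qed
  qed auto
  then show ?thesis by (simp add: sum.reindex)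
qed

subsection \<open>The greedy rounds\<close>

locale distorted_greedy = adaptive_revenue p E g
  for p :: "('e \<Rightarrow> 'o) pmf" and E :: "'e set" and g :: "'e set \<Rightarrow> ('e \<Rightarrow> 'o) \<Rightarrow> real" +
  fixes c :: "'e \<Rightarrow> real" and k :: nat and M :: "nat \<Rightarrow> ('e \<rightharpoonup> 'o) \<Rightarrow> ('e + nat) set"
  assumes cost_nonneg: "e \<in> E \<Longrightarrow> 0 \<le> c e"
    and k_pos: "1 \<le> k"
    and rule: "candidate_rule p E g c k M"
begin

definition picks :: "nat \<Rightarrow> ('e \<rightharpoonup> 'o) \<Rightarrow> 'e set" where
  "picks i \<psi> = {e. Inl e \<in> M i \<psi>}"

abbreviation q :: real where
  "q \<equiv> 1 - 1 / real k"

lemma q_nonneg: "0 \<le> q"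
  using k_pos by simp

lemma finite_extended_items: "finite (extended_items E k)"
  by (simp add: extended_items_def finite_items)

context
  fixes i \<psi>
  assumes i: "i < k" and \<psi>: "feasible p E \<psi>"
begin

lemma max_candidates_rule: "max_candidates p E g c k i \<psi> (M i \<psi>)"
  using rule i \<psi> by (auto simp: candidate_rule_def)

lemma candidates_subset: "M i \<psi> \<subseteq> extended_items E k"
  and candidates_card_le: "card (M i \<psi>) \<le> k"
  using max_candidates_rule by (auto simp: max_candidates_def is_arg_max_def)

lemma candidates_finite: "finite (M i \<psi>)"
  using candidates_subset finite_extended_items by (rule finite_subset)

lemma picks_subset: "picks i \<psi> \<subseteq> E"
  using candidates_subset by (auto simp: picks_def extended_items_def)

text \<open>A maximizer with fewer than \<open>k\<close> elements, one of them a proper item, could be padded with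
  dummies to a maximizer with exactly \<open>k\<close> elements.\<close>

lemma candidates_full:
  assumes "e \<in> picks i \<psi>"
  shows "card (M i \<psi>) = k"
proof -
  let ?D = "Inr ` {..<k - 1} :: ('e + nat) set"
  have "Inl e \<in> M i \<psi>" using assms by (simp add: picks_def)
  \<comment> \<open>One proper item and all \<open>k - 1\<close> dummies make \<open>k\<close>
    elements, so a set of size exactly \<open>k\<close> fits between \<open>M i \<psi>\<close> and
    its union with the dummies.\<close>
  then have "insert (Inl e) ?D \<subseteq> M i \<psi> \<union> ?D" by auto
  then have "card (insert (Inl e) ?D) \<le> card (M i \<psi> \<union> ?D)"
    by (intro card_mono) (auto simp: candidates_finite)
  moreover have "card (insert (Inl e) ?D) = k"
    using k_pos by (subst card_insert_disjoint) (auto simp: card_image)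
  ultimately obtain X where X: "M i \<psi> \<subseteq> X" "X \<subseteq> M i \<psi> \<union> ?D" "card X = k"
    using exists_subset_between[OF candidates_card_le, of "M i \<psi> \<union> ?D"] candidates_finite by auto
  have fin: "finite X" using X(2) candidates_finite by (auto intro: finite_subset)
  have "(\<Sum>x\<in>X. distorted_gain p g c k i \<psi> x) = (\<Sum>x\<in>M i \<psi>. distorted_gain p g c k i \<psi> x)"
    using X by (intro sum.mono_neutral_right fin) (auto simp: distorted_gain_def)
  moreover have "X \<subseteq> extended_items E k"
    using X(2) candidates_subset by (auto simp: extended_items_def)
  ultimately have "max_candidates p E g c k i \<psi> X"
    using max_candidates_rule X(3) by (auto simp: max_candidates_def is_arg_max_def)
  then show ?thesis
    using rule i \<psi> X(3) by (auto simp: candidate_rule_def)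
qed

text \<open>Tagged with \<open>Inl\<close>, the set \<open>U\<close> is itself admissible in the
  maximization, and the dummies in \<open>M i \<psi>\<close> have value 0.\<close>

lemma picks_optimal:
  assumes "U \<subseteq> E" "card U \<le> k"
  shows "(\<Sum>e\<in>U. q ^ (k - (i + 1)) * gain p g \<psi> e - c e)
    \<le> (\<Sum>e\<in>picks i \<psi>. q ^ (k - (i + 1)) * gain p g \<psi> e - c e)"
proof -
  have *: "Inl ` U \<subseteq> extended_items E k \<and> card (Inl ` U :: ('e + nat) set) \<le> k"
    using assms by (auto simp: extended_items_def card_image)
  have "(\<Sum>e\<in>U. q ^ (k - (i + 1)) * gain p g \<psi> e - c e)
      = (\<Sum>x\<in>Inl ` U. distorted_gain p g c k i \<psi> x)"
    by (simp add: sum.reindex distorted_gain_def)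
  also have "\<dots> \<le> (\<Sum>x\<in>M i \<psi>. distorted_gain p g c k i \<psi> x)"
    using max_candidates_rule * unfolding max_candidates_def is_arg_max_def by (meson not_le)
  also have "\<dots> = (\<Sum>e\<in>picks i \<psi>. q ^ (k - (i + 1)) * gain p g \<psi> e - c e)"
    by (subst sum_Inl_part) (simp_all add: candidates_finite distorted_gain_def picks_def)
  finally show ?thesis .
qed

lemma ardg_step_subset:
  assumes "S \<subseteq> E"
  shows "set_pmf (ardg_step (M i \<psi>) S) \<subseteq> Pow E"
  using assms candidates_subset candidates_finite
  by (auto simp: ardg_step_def set_pmf_of_set extended_items_def split: sum.splits)

text \<open>In the uniform average over the candidates a dummy adds no increment, and each proper
  item adds its own with probability \<open>1/k\<close>.\<close>

lemma avg_ardg_step: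
  assumes "S \<subseteq> E"
  shows "avg E (ardg_step (M i \<psi>) S) f = f S + (\<Sum>e\<in>picks i \<psi>. f (insert e S) - f S) / k"
proof (cases "M i \<psi> = {}")
  case True
  then show ?thesis
    using assms finite_items by (simp add: ardg_step_def avg_return picks_def)
next
  case False
  let ?C = "M i \<psi>"
  let ?ins = "\<lambda>x. case x of Inl e \<Rightarrow> insert e S | Inr d \<Rightarrow> S"
  have card: "card ?C > 0"
    using False candidates_finite by (simp add: card_gt_0_iff)
  have "avg E (ardg_step ?C S) f = (\<Sum>x\<in>?C. f (?ins x)) / card ?C"
    using expectation_eq_avg[OF finite_items ardg_step_subset[OF assms], of f] False candidates_finite
    by (simp add: ardg_step_def integral_pmf_of_set)
  also have "(\<Sum>x\<in>?C. f (?ins x)) = card ?C * f S + (\<Sum>x\<in>?C. f (?ins x) - f S)"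
    by (simp add: sum_subtractf)
  also have "(\<Sum>x\<in>?C. f (?ins x) - f S) = (\<Sum>e\<in>picks i \<psi>. f (insert e S) - f S)"
    by (subst sum_Inl_part) (simp_all add: candidates_finite picks_def)
  also have "(card ?C * f S + \<dots>) / card ?C = f S + \<dots> / card ?C"
    using card by (simp add: add_divide_distrib)
  \<comment> \<open>A proper candidate forces exactly \<open>k\<close> candidates; without one the
    sum is empty and the divisor immaterial.\<close>
  also have "\<dots> = f S + (\<Sum>e\<in>picks i \<psi>. f (insert e S) - f S) / k"
    using candidates_full by (cases "picks i \<psi> = {}") auto
  finally show ?thesis .
qed

end

lemma ardg_subset:
  assumes "\<phi> \<in> set_pmf p" "i \<le> k"
  shows "set_pmf (ardg M \<phi> i) \<subseteq> Pow E"
  using assms(2)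
proof (induction i)
  case (Suc i)
  show ?case
    unfolding ardg_Suc set_bind_pmf
  proof (rule UN_least)
    fix S assume "S \<in> set_pmf (ardg M \<phi> i)"
    then have "S \<subseteq> E" using Suc by auto
    then show "set_pmf (ardg_step (M i (observed \<phi> S)) S) \<subseteq> Pow E"
      using Suc.prems by (intro ardg_step_subset feasible_observed[OF assms(1)]) auto
  qed
qed simp

lemma avg_ardg_Suc:
  assumes "\<phi> \<in> set_pmf p" "i < k"
  shows "avg E (ardg M \<phi> (Suc i)) f =
    avg E (ardg M \<phi> i) (\<lambda>S. f S + (\<Sum>e\<in>picks i (observed \<phi> S). f (insert e S) - f S) / k)"
proof -
  have "avg E (ardg M \<phi> (Suc i)) f
      = (\<Sum>S\<in>Pow E. pmf (ardg M \<phi> i) S * avg E (ardg_step (M i (observed \<phi> S)) S) f)"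
    unfolding ardg_Suc using finite_items assms
    by (intro avg_bind ardg_subset ardg_step_subset feasible_observed[OF assms(1)]) auto
  also have "\<dots> = (\<Sum>S\<in>Pow E. pmf (ardg M \<phi> i) S *
      (f S + (\<Sum>e\<in>picks i (observed \<phi> S). f (insert e S) - f S) / k))"
    using assms by (intro sum.cong refl) (simp add: avg_ardg_step feasible_observed)
  finally show ?thesis unfolding avg_def .
qed

end

text \<open>With \<open>m = k - 1\<close> positive, the right-hand side is the reciprocal of
  \<open>(1 + 1/m)^m\<close>, and \<open>1 + 1/m \<le> exp (1/m)\<close>. For \<open>k = 1\<close>
  it is \<open>0^0 = 1\<close>.\<close>

lemma exp_neg1_le:
  assumes "1 \<le> k"
  shows "1 / exp 1 \<le> (1 - 1 / real k) ^ (k - 1)"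
proof (cases "k = 1")
  case False
  define m where "m = k - 1"
  have m: "real k = real m + 1" "0 < m" using assms False by (auto simp: m_def)
  have "(1 + 1 / real m) ^ m \<le> exp (1 / real m) ^ m"
    by (intro power_mono exp_ge_add_one_self) auto
  also have "\<dots> = exp 1"
    using m by (simp flip: exp_of_nat_mult)
  finally have "1 / exp 1 \<le> 1 / (1 + 1 / real m) ^ m"
    using m by (intro divide_left_mono) (auto intro!: mult_pos_pos zero_less_power add_pos_pos)
  also have "\<dots> = (1 - 1 / real k) ^ m"
    unfolding power_one_over[symmetric] using m by (intro arg_cong[where f="\<lambda>x. x ^ m"]) (simp add: field_simps)
  finally show ?thesis by (simp add: m_def)
qed simp

section \<open>Revenue of the greedy set united with a further selection\<close>

context distorted_greedy
begin

lemma integrable_avg_picks: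
  assumes "i < k" "S \<subseteq> E" "\<And>e. e \<in> E \<Longrightarrow> integrable (measure_pmf p) (f e)"
  shows "integrable (measure_pmf p) (\<lambda>\<phi>. \<Sum>e\<in>picks i (observed \<phi> S). f e \<phi> :: real)"
  using assms picks_subset[OF assms(1) feasible_observed[OF _ assms(2)]]
  by (intro integrable_random_sum[OF finite_items]) auto

text \<open>Running \<open>K\<close> first, the greedy rounds only see the larger partial realization on \<open>S \<union> U\<close>, where
  adaptive submodularity and nonnegativity bound the loss of each round by a fraction \<open>1/k\<close>.\<close>

lemma expected_union_Suc:
  assumes "i < k" and K: "\<And>U. weight U (\<lambda>\<phi>. pmf (K \<phi>) U)"
  shows "expected (\<lambda>\<phi>. avg E (ardg M \<phi> (Suc i)) (\<lambda>S. avg E (K \<phi>) (\<lambda>U. g (S \<union> U) \<phi>)))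
    \<ge> q * expected (\<lambda>\<phi>. avg E (ardg M \<phi> i) (\<lambda>S. avg E (K \<phi>) (\<lambda>U. g (S \<union> U) \<phi>)))"
proof -
  \<comment> \<open>\<open>?w (S, U)\<close> is the probability, given \<open>\<phi>\<close>, of the
    greedy set \<open>S\<close> together with an independent draw \<open>U\<close> from
    \<open>K \<phi>\<close>. It depends only on the states in \<open>S \<union> U\<close>.\<close>
  let ?w = "\<lambda>(S, U) \<phi>. pmf (ardg M \<phi> i) S * pmf (K \<phi>) U"
  let ?g = "\<lambda>(S, U) \<phi>. g (S \<union> U) \<phi>"
  let ?R = "\<lambda>(S, U) \<phi>. \<Sum>e\<in>picks i (observed \<phi> S). g (insert e (S \<union> U)) \<phi> - g (S \<union> U) \<phi>"
  let ?I = "Pow E \<times> Pow E"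
  let ?T = "\<lambda>(S, U). S \<union> U"
  have w: "weight (?T x) (?w x)" if "x \<in> ?I" for x
  proof -
    obtain S U where x: "x = (S, U)" by force
    then have "finite S" using that finite_items by (auto intro: finite_subset)
    then show ?thesis
      unfolding x prod.case
      by (intro weight_mult weight_mono[OF K] weight_mono[OF weight_ardg]) auto
  qed
  have int: "integrable p (?g x)" "integrable p (?R x)" if "x \<in> ?I" for x
    using that \<open>i < k\<close>
    by (auto intro!: integrable_revenue integrable_avg_picks Bochner_Integration.integrable_diff)
  \<comment> \<open>The picks are determined by the states in \<open>S\<close>, hence by those in
    \<open>S \<union> U\<close>, so the bound for a chosen set applies with
    \<open>T = S \<union> U\<close>.\<close>
  have ge: "- expected (\<lambda>\<phi>. ?w x \<phi> * ?g x \<phi>) \<le> expected (\<lambda>\<phi>. ?w x \<phi> * ?R x \<phi>)" if "x \<in> ?I" for x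
  proof -
    obtain S U where x: "x = (S, U)" by force
    then have SU: "S \<subseteq> E" "U \<subseteq> E" using that by auto
    have sub: "picks i (observed \<phi> S) \<subseteq> E" if "\<phi> \<in> set_pmf p" for \<phi>
      by (intro picks_subset \<open>i < k\<close> feasible_observed that SU)
    have cong: "picks i (observed \<phi> S) = picks i (observed \<phi>' S)"
      if "observed \<phi> (S \<union> U) = observed \<phi>' (S \<union> U)" for \<phi> \<phi>'
      using observed_eq_mono[OF that, of S] by simp
    note W = w[OF that, unfolded x prod.case]
    have "S \<union> U \<subseteq> E" using SU by simp
    note random = expected_random_gain[OF W this] expected_random_gain_ge[OF W this]
    show ?thesis
      unfolding x prod.case
      by (subst random(1)) (rule sub cong random(2); assumption?)+
  qed
  have "q * expected (\<lambda>\<phi>. avg E (ardg M \<phi> i) (\<lambda>S. avg E (K \<phi>) (\<lambda>U. g (S \<union> U) \<phi>)))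
      = q * (\<Sum>x\<in>?I. expected (\<lambda>\<phi>. ?w x \<phi> * ?g x \<phi>))"
    by (intro arg_cong[where f="(*) q"] expectation_weighted_sum[OF w int(1)])
      (auto simp: avg_def sum_distrib_left sum.cartesian_product mult.assoc intro!: sum.cong)
  \<comment> \<open>The factor \<open>q\<close> is \<open>1 - 1/k\<close>, and the part it takes
    away is the lower bound of \<open>ge\<close> divided by \<open>k\<close>.\<close>
  also have "\<dots> = (\<Sum>x\<in>?I. expected (\<lambda>\<phi>. ?w x \<phi> * ?g x \<phi>) + - expected (\<lambda>\<phi>. ?w x \<phi> * ?g x \<phi>) / k)"
    by (simp add: algebra_simps sum_distrib_left sum_subtractf sum_negf sum_divide_distrib)
  also have "\<dots> \<le> (\<Sum>x\<in>?I. expected (\<lambda>\<phi>. ?w x \<phi> * ?g x \<phi>) + expected (\<lambda>\<phi>. ?w x \<phi> * ?R x \<phi>) / k)"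
    using ge by (intro sum_mono add_left_mono divide_right_mono) auto
  also have "\<dots> = (\<Sum>x\<in>?I. expected (\<lambda>\<phi>. ?w x \<phi> * (?g x \<phi> + ?R x \<phi> / k)))"
    unfolding distrib_left times_divide_eq_right integral_divide_zero[symmetric]
    by (intro sum.cong refl Bochner_Integration.integral_add[symmetric] Bochner_Integration.integrable_divide_zero
        integrable_weight[OF w] int) auto
  also have "\<dots> = expected (\<lambda>\<phi>. avg E (ardg M \<phi> (Suc i)) (\<lambda>S. avg E (K \<phi>) (\<lambda>U. g (S \<union> U) \<phi>)))"
  proof (rule expectation_weighted_sum[OF w, symmetric])
    fix \<phi> assume "\<phi> \<in> set_pmf p"
    then have "avg E (ardg M \<phi> (Suc i)) (\<lambda>S. avg E (K \<phi>) (\<lambda>U. g (S \<union> U) \<phi>)) =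
        avg E (ardg M \<phi> i) (\<lambda>S. avg E (K \<phi>) (\<lambda>U. g (S \<union> U) \<phi>) +
          (\<Sum>e\<in>picks i (observed \<phi> S). avg E (K \<phi>) (\<lambda>U. g (insert e S \<union> U) \<phi>) - avg E (K \<phi>) (\<lambda>U. g (S \<union> U) \<phi>)) / k)"
      using \<open>i < k\<close> by (rule avg_ardg_Suc)
    \<comment> \<open>The average over \<open>U\<close> commutes with the sum over the picks, since
      these do not depend on \<open>U\<close>.\<close>
    also have "\<dots> = avg E (ardg M \<phi> i) (\<lambda>S. avg E (K \<phi>) (\<lambda>U. ?g (S, U) \<phi> + ?R (S, U) \<phi> / k))"
      by (simp add: avg_def distrib_left sum.distrib sum_divide_distrib sum_distrib_left
          sum.swap[of _ "Pow E" "picks _ _"] right_diff_distrib sum_subtractf diff_divide_distrib mult_ac)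
    also have "\<dots> = (\<Sum>x\<in>?I. ?w x \<phi> * (?g x \<phi> + ?R x \<phi> / k))"
      unfolding avg_def sum_distrib_left sum.cartesian_product
      by (intro sum.cong) auto
    finally show "avg E (ardg M \<phi> (Suc i)) (\<lambda>S. avg E (K \<phi>) (\<lambda>U. g (S \<union> U) \<phi>)) =
        (\<Sum>x\<in>?I. ?w x \<phi> * (?g x \<phi> + ?R x \<phi> / k))" .
  qed (assumption | intro Bochner_Integration.integrable_add Bochner_Integration.integrable_divide_zero int)+
  finally show ?thesis .
qed

text \<open>One factor \<open>q\<close> per round, starting from the empty greedy set, whose union
  with \<open>U\<close> is \<open>U\<close>.\<close>

lemma expected_union_ge:
  assumes "i \<le> k" and "\<And>U. weight U (\<lambda>\<phi>. pmf (K \<phi>) U)"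
  shows "expected (\<lambda>\<phi>. avg E (ardg M \<phi> i) (\<lambda>S. avg E (K \<phi>) (\<lambda>U. g (S \<union> U) \<phi>)))
    \<ge> q ^ i * expected (\<lambda>\<phi>. avg E (K \<phi>) (\<lambda>U. g U \<phi>))"
  using assms(1)
proof (induction i)
  case 0
  then show ?case by (simp add: avg_return finite_items)
next
  case (Suc i)
  then show ?case
    using expected_union_Suc[of i K] assms(2) q_nonneg
      mult_left_mono[of "q ^ i * expected (\<lambda>\<phi>. avg E (K \<phi>) (\<lambda>U. g U \<phi>))" _ q]
    by fastforce
qed

subsection \<open>The potential\<close>

text \<open>The coefficient of revenue rises to 1 at \<open>i = k\<close>, where the potential is
  the objective of the greedy policy; at \<open>i = 0\<close> it is a nonnegative multiple of the
  expected revenue of the empty set.\<close>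

definition potential :: "nat \<Rightarrow> real" where
  "potential i = expected (\<lambda>\<phi>. avg E (ardg M \<phi> i) (\<lambda>S. q ^ (k - i) * g S \<phi> - sum c S))"

lemma policies_uptoD:
  assumes "\<pi> \<in> policies_upto p E k" "\<phi> \<in> set_pmf p" "U \<in> set_pmf (selected E \<pi> \<phi>)"
  shows "card U \<le> k"
  using assms by (auto simp: policies_upto_def)

text \<open>\<open>F\<close> is the integrand of the potential after round \<open>i\<close>. What
  \<open>\<pi>\<close> adds is bounded by gains over \<open>S\<close>; these, less cost, are bounded
  by those of the picks, which turn back into actual increments.\<close>

lemma expected_picks_ge:
  assumes \<pi>: "\<pi> \<in> policies_upto p E k" and i: "i < k" and S: "S \<subseteq> E" and w: "weight S w"
  defines "a \<equiv> q ^ (k - (i + 1))"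
  defines "F \<equiv> \<lambda>\<phi> S. a * g S \<phi> - sum c S"
  shows "expected (\<lambda>\<phi>. w \<phi> * avg E (selected E \<pi> \<phi>) (\<lambda>U. a * (g (S \<union> U) \<phi> - g S \<phi>) - sum c U))
    \<le> expected (\<lambda>\<phi>. w \<phi> * (\<Sum>e\<in>picks i (observed \<phi> S). F \<phi> (insert e S) - F \<phi> S))"
proof -
  let ?B = "\<lambda>\<phi>. picks i (observed \<phi> S)"
  let ?K = "\<lambda>\<phi>. avg E (selected E \<pi> \<phi>)"
  have policy: "is_policy p E \<pi>" using \<pi> by (simp add: policies_upto_def)
  have a: "0 \<le> a" unfolding a_def using q_nonneg by simp
  have B: "?B \<phi> \<subseteq> E" if "\<phi> \<in> set_pmf p" for \<phi>
    by (intro picks_subset i feasible_observed that S)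
  have B_cong: "?B \<phi> = ?B \<phi>'" if "observed \<phi> S = observed \<phi>' S" for \<phi> \<phi>'
    using that by simp
  note weighted = integrable_weight[OF w]
  have intB: "integrable p (\<lambda>\<phi>. \<Sum>e\<in>?B \<phi>. \<Delta> \<phi> S e)" "integrable p (\<lambda>\<phi>. \<Sum>e\<in>?B \<phi>. g (insert e S) \<phi> - g S \<phi>)"
      "integrable p (\<lambda>\<phi>. \<Sum>e\<in>?B \<phi>. c e)"
    using S by (auto intro!: integrable_avg_picks i integrable_gain integrable_revenue
        Bochner_Integration.integrable_diff)
  have intK: "integrable p (\<lambda>\<phi>. ?K \<phi> (\<lambda>U. g (S \<union> U) \<phi> - g S \<phi>))"
      "integrable p (\<lambda>\<phi>. ?K \<phi> (\<lambda>U. \<Sum>e\<in>U. \<Delta> \<phi> S e))"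
      "integrable p (\<lambda>\<phi>. ?K \<phi> (sum c))"
    using S by (auto intro!: integrable_avg integrable_sum_gain integrable_revenue
        Bochner_Integration.integrable_diff)
  have linear: "expected (\<lambda>\<phi>. w \<phi> * (a * f \<phi> - h \<phi>)) = a * expected (\<lambda>\<phi>. w \<phi> * f \<phi>) - expected (\<lambda>\<phi>. w \<phi> * h \<phi>)"
    if "integrable p f" "integrable p h" for f h
  proof -
    have "expected (\<lambda>\<phi>. w \<phi> * (a * f \<phi> - h \<phi>)) = expected (\<lambda>\<phi>. a * (w \<phi> * f \<phi>) - w \<phi> * h \<phi>)"
      by (simp add: algebra_simps)
    then show ?thesis
      using weighted[OF that(1)] weighted[OF that(2)] by simp
  qed
  have "expected (\<lambda>\<phi>. w \<phi> * ?K \<phi> (\<lambda>U. a * (g (S \<union> U) \<phi> - g S \<phi>) - sum c U))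
      = a * expected (\<lambda>\<phi>. w \<phi> * ?K \<phi> (\<lambda>U. g (S \<union> U) \<phi> - g S \<phi>)) - expected (\<lambda>\<phi>. w \<phi> * ?K \<phi> (sum c))"
    unfolding avg_diff[of E _ "\<lambda>U. a * _ U"] avg_cmult by (rule linear[OF intK(1,3)])
  also have "\<dots> \<le> a * expected (\<lambda>\<phi>. w \<phi> * ?K \<phi> (\<lambda>U. \<Sum>e\<in>U. \<Delta> \<phi> S e)) - expected (\<lambda>\<phi>. w \<phi> * ?K \<phi> (sum c))"
    by (intro diff_right_mono mult_left_mono expected_policy_gain[OF policy S w] a)
  also have "\<dots> = expected (\<lambda>\<phi>. w \<phi> * (a * ?K \<phi> (\<lambda>U. \<Sum>e\<in>U. \<Delta> \<phi> S e) - ?K \<phi> (sum c)))"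
    by (rule linear[OF intK(2,3), symmetric])
  also have "\<dots> \<le> expected (\<lambda>\<phi>. w \<phi> * (a * (\<Sum>e\<in>?B \<phi>. \<Delta> \<phi> S e) - (\<Sum>e\<in>?B \<phi>. c e)))"
  proof (intro expectation_mono weighted mult_left_mono weight_nonneg[OF w] Bochner_Integration.integrable_diff
      Bochner_Integration.integrable_mult_right intK intB)
    fix \<phi> assume \<phi>: "\<phi> \<in> set_pmf p"
    have sub: "set_pmf (selected E \<pi> \<phi>) \<subseteq> Pow E"
      unfolding selected_def by (intro run_policy_subset[OF policy \<phi>]) simp
    have "a * ?K \<phi> (\<lambda>U. \<Sum>e\<in>U. \<Delta> \<phi> S e) - ?K \<phi> (sum c) = ?K \<phi> (\<lambda>U. \<Sum>e\<in>U. a * \<Delta> \<phi> S e - c e)"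
      by (simp add: avg_diff avg_cmult sum_subtractf flip: sum_distrib_left)
    \<comment> \<open>Every set selected by \<open>\<pi>\<close> has at most \<open>k\<close> items,
      so it competes with the picks under each realization separately.\<close>
    also have "\<dots> \<le> ?K \<phi> (\<lambda>_. \<Sum>e\<in>?B \<phi>. a * \<Delta> \<phi> S e - c e)"
      unfolding a_def
      by (intro avg_mono picks_optimal i feasible_observed[OF \<phi> S] policies_uptoD[OF \<pi> \<phi>])
    also have "\<dots> = (\<Sum>e\<in>?B \<phi>. a * \<Delta> \<phi> S e - c e)"
      by (rule avg_const[OF finite_items sub])
    finally show "a * ?K \<phi> (\<lambda>U. \<Sum>e\<in>U. \<Delta> \<phi> S e) - ?K \<phi> (sum c)
        \<le> a * (\<Sum>e\<in>?B \<phi>. \<Delta> \<phi> S e) - (\<Sum>e\<in>?B \<phi>. c e)"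
      by (simp add: sum_subtractf sum_distrib_left)
  qed
  also have "\<dots> = a * expected (\<lambda>\<phi>. w \<phi> * (\<Sum>e\<in>?B \<phi>. \<Delta> \<phi> S e)) - expected (\<lambda>\<phi>. w \<phi> * (\<Sum>e\<in>?B \<phi>. c e))"
    by (rule linear[OF intB(1,3)])
  \<comment> \<open>The picks are determined by the states in \<open>S\<close>, so gains and actual
    increments agree in expectation.\<close>
  also have "expected (\<lambda>\<phi>. w \<phi> * (\<Sum>e\<in>?B \<phi>. \<Delta> \<phi> S e)) = expected (\<lambda>\<phi>. w \<phi> * (\<Sum>e\<in>?B \<phi>. g (insert e S) \<phi> - g S \<phi>))"
    by (rule expected_random_gain[OF w S B B_cong, symmetric])
  also have "a * \<dots> - expected (\<lambda>\<phi>. w \<phi> * (\<Sum>e\<in>?B \<phi>. c e))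
      = expected (\<lambda>\<phi>. w \<phi> * (a * (\<Sum>e\<in>?B \<phi>. g (insert e S) \<phi> - g S \<phi>) - (\<Sum>e\<in>?B \<phi>. c e)))"
    by (rule linear[OF intB(2,3), symmetric])
  also have "\<dots> \<le> expected (\<lambda>\<phi>. w \<phi> * (\<Sum>e\<in>?B \<phi>. F \<phi> (insert e S) - F \<phi> S))"
  proof (intro expectation_mono weighted mult_left_mono weight_nonneg[OF w] Bochner_Integration.integrable_diff
      Bochner_Integration.integrable_mult_right intB)
    show "integrable p (\<lambda>\<phi>. \<Sum>e\<in>?B \<phi>. F \<phi> (insert e S) - F \<phi> S)"
      unfolding F_def using S
      by (auto intro!: integrable_avg_picks i integrable_revenue Bochner_Integration.integrable_diff)
  next
    fix \<phi> assume \<phi>: "\<phi> \<in> set_pmf p"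
    have "finite S" using S finite_items by (rule finite_subset)
    have "a * (\<Sum>e\<in>?B \<phi>. g (insert e S) \<phi> - g S \<phi>) - (\<Sum>e\<in>?B \<phi>. c e)
        = (\<Sum>e\<in>?B \<phi>. a * (g (insert e S) \<phi> - g S \<phi>) - c e)"
      by (simp add: sum_subtractf flip: sum_distrib_left)
    also have "\<dots> \<le> (\<Sum>e\<in>?B \<phi>. F \<phi> (insert e S) - F \<phi> S)"
    proof (rule sum_mono)
      fix e assume "e \<in> ?B \<phi>"
      then have "0 \<le> c e" using B[OF \<phi>] cost_nonneg by auto
      \<comment> \<open>A pick already in \<open>S\<close> adds no cost; charging \<open>c e\<close>
        for it anyway is safe because costs are nonnegative.\<close>
      then have "sum c (insert e S) \<le> c e + sum c S"
        using \<open>finite S\<close> by (cases "e \<in> S") (auto simp: insert_absorb)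
      then show "a * (g (insert e S) \<phi> - g S \<phi>) - c e \<le> F \<phi> (insert e S) - F \<phi> S"
        unfolding F_def by (simp add: algebra_simps)
    qed
    finally show "a * (\<Sum>e\<in>?B \<phi>. g (insert e S) \<phi> - g S \<phi>) - (\<Sum>e\<in>?B \<phi>. c e)
        \<le> (\<Sum>e\<in>?B \<phi>. F \<phi> (insert e S) - F \<phi> S)" .
  qed
  finally show ?thesis .
qed

text \<open>The subtracted \<open>g S\<close> in the increment \<open>g (S \<union> U) - g S\<close>
  costs \<open>a / k * g S\<close>, exactly the drop from \<open>a\<close> to
  \<open>a * q = q ^ (k - i)\<close>, the coefficient before the round. What is left is
  \<open>a / k\<close> times the revenue of the union, which is at least \<open>q ^ i\<close> times
  that of \<open>\<pi>\<close> in expectation.\<close>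

lemma potential_Suc:
  assumes \<pi>: "\<pi> \<in> policies_upto p E k" and i: "i < k"
  shows "potential (Suc i) \<ge> potential i + (q ^ (k - 1) * expected (\<lambda>\<phi>. avg E (selected E \<pi> \<phi>) (\<lambda>U. g U \<phi>))
    - expected (\<lambda>\<phi>. avg E (selected E \<pi> \<phi>) (sum c))) / k"
proof -
  define a where "a = q ^ (k - (i + 1))"
  have a: "0 \<le> a" unfolding a_def using q_nonneg by simp
  have "k - i = Suc (k - (i + 1))" using i by simp
  then have a_Suc: "q ^ (k - i) = a * q" by (simp add: a_def)
  \<comment> \<open>The exponents \<open>k - (i + 1)\<close> and \<open>i\<close> add up to
    \<open>k - 1\<close>, so the guaranteed growth is the same in every round.\<close>
  have a_power: "a * q ^ i = q ^ (k - 1)"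
    unfolding a_def power_add[symmetric] using i by simp
  let ?K = "\<lambda>\<phi>. avg E (selected E \<pi> \<phi>)"
  let ?r = "\<lambda>\<phi>. avg E (ardg M \<phi> i)"
  let ?F = "\<lambda>\<phi> S. a * g S \<phi> - sum c S"
  let ?R = "\<lambda>S \<phi>. \<Sum>e\<in>picks i (observed \<phi> S). ?F \<phi> (insert e S) - ?F \<phi> S"
  let ?L = "\<lambda>S \<phi>. ?K \<phi> (\<lambda>U. a * (g (S \<union> U) \<phi> - g S \<phi>) - sum c U)"
  let ?w = "\<lambda>S \<phi>. pmf (ardg M \<phi> i) S"
  have sub: "set_pmf (selected E \<pi> \<phi>) \<subseteq> Pow E" if "\<phi> \<in> set_pmf p" for \<phi>
    using \<pi> that unfolding selected_def policies_upto_def by (intro run_policy_subset) auto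
  have K: "weight U (\<lambda>\<phi>. pmf (selected E \<pi> \<phi>) U)" for U
    unfolding selected_def by (rule weight_run_policy)
  have w: "weight S (?w S)" if "S \<in> Pow E" for S
    using that finite_items by (intro weight_ardg) (auto intro: finite_subset)
  have int: "integrable p (\<lambda>\<phi>. ?F \<phi> S)" "integrable p (?R S)" "integrable p (?L S)" if "S \<in> Pow E" for S
    using that by (auto intro!: integrable_avg integrable_avg_picks i integrable_revenue
        Bochner_Integration.integrable_diff)
  have split: "expected (\<lambda>\<phi>. ?w S \<phi> * (?F \<phi> S + h \<phi> / real k))
      = expected (\<lambda>\<phi>. ?w S \<phi> * ?F \<phi> S) + expected (\<lambda>\<phi>. ?w S \<phi> * h \<phi>) / k"
    if "S \<in> Pow E" "integrable p h" for S and h :: "('e \<Rightarrow> 'o) \<Rightarrow> real"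
    unfolding distrib_left times_divide_eq_right integral_divide_zero[symmetric]
    by (intro Bochner_Integration.integral_add Bochner_Integration.integrable_divide_zero
        integrable_weight[OF w] int that)
  have step: "?r \<phi> (\<lambda>S. ?F \<phi> S + ?L S \<phi> / k)
      = ?r \<phi> (\<lambda>S. q ^ (k - i) * g S \<phi> - sum c S)
        + (a * ?r \<phi> (\<lambda>S. ?K \<phi> (\<lambda>U. g (S \<union> U) \<phi>)) - ?K \<phi> (sum c)) / k"
    if \<phi>: "\<phi> \<in> set_pmf p" for \<phi>
  proof -
    have "?F \<phi> S + ?L S \<phi> / k = (q ^ (k - i) * g S \<phi> - sum c S) + (a / k * ?K \<phi> (\<lambda>U. g (S \<union> U) \<phi>) - ?K \<phi> (sum c) / k)" for S
    proof -
      have "?L S \<phi> = a * (?K \<phi> (\<lambda>U. g (S \<union> U) \<phi>) - g S \<phi>) - ?K \<phi> (sum c)"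
        unfolding avg_diff avg_cmult avg_const[OF finite_items sub[OF \<phi>]] ..
      then show ?thesis
        using k_pos by (simp only: a_Suc) (simp add: field_simps)
    qed
    then have "?r \<phi> (\<lambda>S. ?F \<phi> S + ?L S \<phi> / k)
        = ?r \<phi> (\<lambda>S. (q ^ (k - i) * g S \<phi> - sum c S) + (a / k * ?K \<phi> (\<lambda>U. g (S \<union> U) \<phi>) - ?K \<phi> (sum c) / k))"
      by presburger
    also have "\<dots> = ?r \<phi> (\<lambda>S. q ^ (k - i) * g S \<phi> - sum c S)
        + (a / k * ?r \<phi> (\<lambda>S. ?K \<phi> (\<lambda>U. g (S \<union> U) \<phi>)) - ?K \<phi> (sum c) / k)"
      using i by (simp only: avg_add avg_diff avg_cmult avg_const[OF finite_items ardg_subset[OF \<phi> less_imp_le]])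
    finally show ?thesis by (simp add: diff_divide_distrib)
  qed
  have intE: "integrable p (\<lambda>\<phi>. ?r \<phi> (\<lambda>S. q ^ (k - i) * g S \<phi> - sum c S))"
      "integrable p (\<lambda>\<phi>. ?r \<phi> (\<lambda>S. ?K \<phi> (\<lambda>U. g (S \<union> U) \<phi>)))"
      "integrable p (\<lambda>\<phi>. ?K \<phi> (sum c))"
    by (auto intro!: integrable_avg integrable_revenue Bochner_Integration.integrable_diff)
  have "a * (q ^ i * expected (\<lambda>\<phi>. ?K \<phi> (\<lambda>U. g U \<phi>))) \<le> a * expected (\<lambda>\<phi>. ?r \<phi> (\<lambda>S. ?K \<phi> (\<lambda>U. g (S \<union> U) \<phi>)))"
    using i by (intro mult_left_mono expected_union_ge K a) simp
  then have "potential i + (q ^ (k - 1) * expected (\<lambda>\<phi>. ?K \<phi> (\<lambda>U. g U \<phi>)) - expected (\<lambda>\<phi>. ?K \<phi> (sum c))) / k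
      \<le> potential i + (a * expected (\<lambda>\<phi>. ?r \<phi> (\<lambda>S. ?K \<phi> (\<lambda>U. g (S \<union> U) \<phi>))) - expected (\<lambda>\<phi>. ?K \<phi> (sum c))) / k"
    unfolding mult.assoc[symmetric] a_power
    by (intro add_left_mono divide_right_mono diff_right_mono) auto
  also have "\<dots> = expected (\<lambda>\<phi>. ?r \<phi> (\<lambda>S. q ^ (k - i) * g S \<phi> - sum c S)
        + (a * ?r \<phi> (\<lambda>S. ?K \<phi> (\<lambda>U. g (S \<union> U) \<phi>)) - ?K \<phi> (sum c)) / k)"
    unfolding potential_def using intE by simp
  also have "\<dots> = expected (\<lambda>\<phi>. ?r \<phi> (\<lambda>S. ?F \<phi> S + ?L S \<phi> / k))"
    by (intro expectation_cong step[symmetric])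
  \<comment> \<open>Split by the greedy set \<open>S\<close>: its probability is a weight on
    \<open>S\<close>, as the comparison with the picks demands.\<close>
  also have "\<dots> = (\<Sum>S\<in>Pow E. expected (\<lambda>\<phi>. ?w S \<phi> * (?F \<phi> S + ?L S \<phi> / k)))"
    by (intro expectation_weighted_sum[OF w] Bochner_Integration.integrable_add
        Bochner_Integration.integrable_divide_zero int) (simp_all add: avg_def)
  also have "\<dots> = (\<Sum>S\<in>Pow E. expected (\<lambda>\<phi>. ?w S \<phi> * ?F \<phi> S) + expected (\<lambda>\<phi>. ?w S \<phi> * ?L S \<phi>) / k)"
    by (intro sum.cong refl split int)
  also have "\<dots> \<le> (\<Sum>S\<in>Pow E. expected (\<lambda>\<phi>. ?w S \<phi> * ?F \<phi> S) + expected (\<lambda>\<phi>. ?w S \<phi> * ?R S \<phi>) / k)"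
  proof (intro sum_mono add_left_mono divide_right_mono)
    fix S assume S: "S \<in> Pow E"
    show "expected (\<lambda>\<phi>. ?w S \<phi> * ?L S \<phi>) \<le> expected (\<lambda>\<phi>. ?w S \<phi> * ?R S \<phi>)"
      using expected_picks_ge[OF \<pi> i _ w[OF S]] S unfolding a_def by blast
  qed simp
  also have "\<dots> = (\<Sum>S\<in>Pow E. expected (\<lambda>\<phi>. ?w S \<phi> * (?F \<phi> S + ?R S \<phi> / k)))"
    by (intro sum.cong refl split[symmetric] int)
  also have "\<dots> = expected (\<lambda>\<phi>. ?r \<phi> (\<lambda>S. ?F \<phi> S + ?R S \<phi> / k))"
    by (intro expectation_weighted_sum[OF w, symmetric] Bochner_Integration.integrable_add
        Bochner_Integration.integrable_divide_zero int) (simp_all add: avg_def)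
  also have "\<dots> = potential (Suc i)"
    unfolding potential_def using i
    by (intro expectation_cong) (simp add: avg_ardg_Suc a_def del: ardg.simps)
  finally show ?thesis .
qed

text \<open>The potential starts nonnegative, collects \<open>k\<close> shares of size
  \<open>1/k\<close>, and ends as the objective of the greedy policy.\<close>

lemma greedy_bound:
  assumes \<pi>: "\<pi> \<in> policies_upto p E k"
  shows "g_avg p g (\<lambda>\<phi>. ardg M \<phi> k) - c_avg p c (\<lambda>\<phi>. ardg M \<phi> k)
    \<ge> 1 / exp 1 * g_avg p g (selected E \<pi>) - c_avg p c (selected E \<pi>)"
proof -
  have sub: "set_pmf (selected E \<pi> \<phi>) \<subseteq> Pow E" if "\<phi> \<in> set_pmf p" for \<phi>
    using \<pi> that unfolding selected_def policies_upto_def by (intro run_policy_subset) auto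
  have cost: "0 \<le> sum c S" if "S \<subseteq> E" for S
    using that cost_nonneg by (auto intro!: sum_nonneg)
  have g_avg: "g_avg p g K = expected (\<lambda>\<phi>. avg E (K \<phi>) (\<lambda>S. g S \<phi>))"
    and c_avg: "c_avg p c K = expected (\<lambda>\<phi>. avg E (K \<phi>) (sum c))"
    if "\<And>\<phi>. \<phi> \<in> set_pmf p \<Longrightarrow> set_pmf (K \<phi>) \<subseteq> Pow E" for K
    unfolding g_avg_def c_avg_def
    by (rule expectation_outcome[OF finite_items that nonneg], assumption+)
      (rule expectation_outcome[OF finite_items that cost], assumption+)
  define G where "G = g_avg p g (selected E \<pi>)"
  define C where "C = c_avg p c (selected E \<pi>)"
  have G: "G = expected (\<lambda>\<phi>. avg E (selected E \<pi> \<phi>) (\<lambda>S. g S \<phi>))"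
    unfolding G_def by (intro g_avg sub)
  have C: "C = expected (\<lambda>\<phi>. avg E (selected E \<pi> \<phi>) (sum c))"
    unfolding C_def by (intro c_avg sub)
  have "0 \<le> G"
    unfolding G avg_def using nonneg
    by (intro integral_nonneg_AE) (auto simp: AE_measure_pmf_iff intro!: sum_nonneg mult_nonneg_nonneg)
  have "real i * (q ^ (k - 1) * G - C) / k \<le> potential i" if "i \<le> k" for i
    using that
  proof (induction i)
    case 0
    have "0 \<le> expected (g {})"
      using nonneg by (intro integral_nonneg_AE) (auto simp: AE_measure_pmf_iff)
    then show ?case
      using q_nonneg by (simp add: potential_def avg_return finite_items)
  next
    case (Suc i)
    then show ?case
      using potential_Suc[OF \<pi>, of i]
      unfolding G C
      by (simp add: distrib_right add_divide_distrib)
  qed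
  from this[of k] have "q ^ (k - 1) * G - C \<le> potential k"
    using k_pos by simp
  also have "potential k = expected (\<lambda>\<phi>. avg E (ardg M \<phi> k) (\<lambda>S. g S \<phi>)) - expected (\<lambda>\<phi>. avg E (ardg M \<phi> k) (sum c))"
    unfolding potential_def
    by (simp add: avg_diff integrable_avg integrable_revenue)
  also have "\<dots> = g_avg p g (\<lambda>\<phi>. ardg M \<phi> k) - c_avg p c (\<lambda>\<phi>. ardg M \<phi> k)"
    by (intro arg_cong2[where f="(-)"] g_avg[symmetric] c_avg[symmetric] ardg_subset order.refl)
  \<comment> \<open>Weakening the factor \<open>q ^ (k - 1)\<close> to \<open>1 / exp 1\<close>
    relies on \<open>0 \<le> G\<close>.\<close>
  finally show ?thesis
    using mult_right_mono[OF exp_neg1_le[OF k_pos] \<open>0 \<le> G\<close>] unfolding G_def C_def by linarith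
qed

end

theorem theorem6p1:
  fixes E :: "'e set" and Q :: "'o set"
    and p :: "('e \<Rightarrow> 'o) pmf"
    and g :: "'e set \<Rightarrow> ('e \<Rightarrow> 'o) \<Rightarrow> real"
    and c :: "'e \<Rightarrow> real"
    and k :: nat
    and \<pi>o :: "('e, 'o) policy"
    and M :: "nat \<Rightarrow> ('e \<rightharpoonup> 'o) \<Rightarrow> ('e + nat) set"
  assumes "finite E"
    and "set_pmf p \<subseteq> E \<rightarrow>\<^sub>E Q"
    and "\<And>Y \<phi>. Y \<subseteq> E \<Longrightarrow> \<phi> \<in> E \<rightarrow>\<^sub>E Q \<Longrightarrow> g Y \<phi> \<ge> 0"
    and "\<And>Y. Y \<subseteq> E \<Longrightarrow> integrable (measure_pmf p) (g Y)"
    and "adaptive_submodular p E g"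
    and "\<And>e. e \<in> E \<Longrightarrow> c e \<ge> 0"
    and "k \<ge> 1"
    and "is_arg_max (\<lambda>\<pi>. g_avg p g (selected E \<pi>) - c_avg p c (selected E \<pi>))
           (\<lambda>\<pi>. \<pi> \<in> policies_upto p E k) \<pi>o"
    and "candidate_rule p E g c k M"
  shows "g_avg p g (\<lambda>\<phi>. ardg M \<phi> k) - c_avg p c (\<lambda>\<phi>. ardg M \<phi> k)
           \<ge> 1 / exp 1 * g_avg p g (selected E \<pi>o) - c_avg p c (selected E \<pi>o)"
proof -
  interpret distorted_greedy p E g c k M
    using assms(1-7,9) by unfold_locales auto
  show ?thesis
    using assms(8) by (intro greedy_bound) (simp add: is_arg_max_def)
qed

end
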